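(* Consider $\min_{\mathbf{x}\in\mathbb{R}^n}\max_{\mathbf{y}\in\mathbb{R}^m}F(\mathbf{x})+H(\mathbf{x},\mathbf{y})-G(\mathbf{y})$ with $H(\mathbf{x},\mathbf{y})=\mathbf{x}^\top\mathbf{B}\mathbf{y}-\mathbf{x}^\top\mathbf{u}_{\mathbf{x}}+\mathbf{u}_{\mathbf{y}}^\top\mathbf{y}$, under the convexity/smoothness and oracle assumptions in the context, with unique saddle point $(\boldsymbol{\omega}_{\mathbf{x}}^\star,\boldsymbol{\omega}_{\mathbf{y}}^\star)$. Set $$L_{\mathrm{Str}}=L_F\vee\left(\tfrac{\mu_F}{\mu_G}L_G\right),\quad L_{\mathrm{Bil}}=\sqrt{\lambda_{\max}(\mathbf{B}^\top\mathbf{B})\cdot\tfrac{\mu_F}{\mu_G}},\quad \mu_{\mathrm{Str}}=\mu_F,\quad \mathcal{R}=\tfrac{\mu_G}{\mu_F}.$$ Let the epoch length $\mathscr{T}\ge1$ be known in advance, fix $r\in(0,1)$, $\beta\in(0,\infty)$ and $\mathscr{C}\in(0,\infty)$ arbitrarily, set $\sigma=\frac{1}{\sqrt3}\sqrt{\frac{1}{1-r}\sigma_{\mathrm{Str}}^2+(2+\frac1\beta)\sigma_{\mathrm{Bil}}^2}$, and let $D_0^2=\mathbb{E}\left[\|\mathbf{x}_0-\boldsymbol{\omega}_{\mathbf{x}}^\star\|^2+\mathcal{R}\|\mathbf{y}_0-\boldsymbol{\omega}_{\mathbf{y}}^\star\|^2\right]$ with $D_0>0$. For $\tilde\sigma\ge0$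 define $$\bar\eta_t(\tilde\sigma;\mathscr{T},\mathscr{C},r,\beta)=\frac{t}{\left(\frac2r L_{\mathrm{Str}}\vee\frac{\tilde\sigma[\mathscr{T}(\mathscr{T}+1)^2]^{1/2}}{\mathscr{C}D_0}\right)+\sqrt{\frac{1+\beta}{r}}\,L_{\mathrm{Bil}}\,t},\qquad \mathcal{A}(\tilde\sigma;\mathscr{T},\mathscr{C},r,\beta)=1+\frac{\mathscr{C}\tilde\sigma[\mathscr{T}(\mathscr{T}+1)^2]^{1/2}}{\frac{1}{\bar\eta_1(\tilde\sigma;\mathscr{T},\mathscr{C},r,\beta)}D_0}.$$ Run the single-epoch stochastic AG-EG algorithm (see context) with $\alpha_t=\frac{2}{t+1}$ and $\eta_t=\bar\eta_t(\sigma;\mathscr{T},\mathscr{C},r,\beta)$. Then its output satisfies $$\mathbb{E}\left[\|\mathbf{x}^{\mathrm{ag}}_{\mathscr{T}-\frac12}-\boldsymbol{\omega}_{\mathbf{x}}^\star\|^2+\mathcal{R}\|\mathbf{y}^{\mathrm{ag}}_{\mathscr{T}-\frac12}-\boldsymbol{\omega}_{\mathbf{y}}^\star\|^2\right]\le\frac{2}{\mu_{\mathrm{Str}}(\mathscr{T}+1)}\left(\frac{\frac2rL_{\mathrm{Str}}}{\mathscr{T}}+\mathcal{A}(\sigma;\mathscr{T},\mathscr{C},r,\beta)\sqrt{\tfrac{1+\beta}{r}}\,L_{\mathrm{Bil}}\right)D_0^2+\frac{2(\frac{1}{\mathscr{C}}+\mathscr{C})\sigma}{\mu_{\mathrm{Str}}\mathscr{T}^{1/2}}D_0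 .$$ Moreover the prefactor $\mathcal{A}(\tilde\sigma;\mathscr{T},\mathscr{C},r,\beta)$ lies in $[1,1+\mathscr{C}^2]$ and equals $1$ when $\tilde\sigma=0$.
   Context: Norms are Euclidean; $a\vee b=\max(a,b)$; $\lambda_{\max}$ is the largest eigenvalue. Assumptions. $F:\mathbb{R}^n\to\mathbb{R}$ is differentiable, $L_F$-smooth and $\mu_F$-strongly convex: $\frac{\mu_F}{2}\|\mathbf{x}-\mathbf{x}'\|^2\le F(\mathbf{x})-F(\mathbf{x}')-\nabla F(\mathbf{x}')^\top(\mathbf{x}-\mathbf{x}')\le\frac{L_F}{2}\|\mathbf{x}-\mathbf{x}'\|^2$; likewise $G:\mathbb{R}^m\to\mathbb{R}$ is $L_G$-smooth and $\mu_G$-strongly convex; $\mu_F,\mu_G>0$. $\mathbf{B}\in\mathbb{R}^{n\times m}$ with $n\ge m$ (without loss of generality). There are distributions $\mathcal{D}_\xi,\mathcal{D}_\zeta$ and stochastic gradients $\nabla f(\mathbf{x};\xi),\nabla g(\mathbf{y};\xi),\nabla_{\mathbf{x}}h(\mathbf{x},\mathbf{y};\zeta),\nabla_{\mathbf{y}}h(\mathbf{x},\mathbf{y};\zeta)$ that for all $\mathbf{x},\mathbf{y}$ are unbiased for $\nabla F(\mathbf{x}),\nabla G(\mathbf{y}),\nabla_{\mathbf{x}}H(\mathbf{x},\mathbf{y}),\nabla_{\mathbf{y}}H(\mathbf{x},\mathbf{y})$ and satisfy $\mathbb{E}_\xi[\|\nabla f(\mathbf{x};\xi)-\nabla F(\mathbf{x})\|^2+\frac{1}{\mathcal{R}}\|\nabla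 g(\mathbf{y};\xi)-\nabla G(\mathbf{y})\|^2]\le\sigma_{\mathrm{Str}}^2$ and $\mathbb{E}_\zeta[\|\nabla_{\mathbf{x}}h-\nabla_{\mathbf{x}}H\|^2+\frac{1}{\mathcal{R}}\|\nabla_{\mathbf{y}}h-\nabla_{\mathbf{y}}H\|^2]\le\sigma_{\mathrm{Bil}}^2$. A saddle point satisfies $\mathscr{F}(\boldsymbol{\omega}_{\mathbf{x}}^\star,\mathbf{y})\le\mathscr{F}(\boldsymbol{\omega}_{\mathbf{x}}^\star,\boldsymbol{\omega}_{\mathbf{y}}^\star)\le\mathscr{F}(\mathbf{x},\boldsymbol{\omega}_{\mathbf{y}}^\star)$ for all $\mathbf{x},\mathbf{y}$, where $\mathscr{F}=F+H-G$. Single-epoch stochastic AG-EG algorithm: from a (possibly random, square-integrable) $[\mathbf{x}_0;\mathbf{y}_0]$ set $\mathbf{x}^{\mathrm{ag}}_{-1/2}=\mathbf{x}^{\mathrm{md}}_0=\mathbf{x}_0$, $\mathbf{y}^{\mathrm{ag}}_{-1/2}=\mathbf{y}^{\mathrm{md}}_0=\mathbf{y}_0$. For $t=1,\dots,\mathscr{T}$ draw $\xi_{t-\frac12}\sim\mathcal{D}_\xi$ and $\zeta_{t-\frac12},\zeta_t\sim\mathcal{D}_\zeta$ (all samples independent of each other, of the past and of the initialization) and set $\mathbf{x}_{t-\frac12}=\mathbf{x}_{t-1}-\eta_t(\nabla f(\mathbf{x}^{\mathrm{md}}_{t-1};\xi_{t-\frac12})+\nabla_{\mathbf{x}}h(\mathbf{x}_{t-1},\mathbf{y}_{t-1};\zeta_{t-\frac12}))$,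 $\mathbf{y}_{t-\frac12}=\mathbf{y}_{t-1}-\frac{\eta_t}{\mathcal{R}}(-\nabla_{\mathbf{y}}h(\mathbf{x}_{t-1},\mathbf{y}_{t-1};\zeta_{t-\frac12})+\nabla g(\mathbf{y}^{\mathrm{md}}_{t-1};\xi_{t-\frac12}))$, $\mathbf{x}^{\mathrm{ag}}_{t-\frac12}=(1-\alpha_t)\mathbf{x}^{\mathrm{ag}}_{t-\frac32}+\alpha_t\mathbf{x}_{t-\frac12}$, $\ \mathbf{y}^{\mathrm{ag}}_{t-\frac12}=(1-\alpha_t)\mathbf{y}^{\mathrm{ag}}_{t-\frac32}+\alpha_t\mathbf{y}_{t-\frac12}$, $\mathbf{x}_t=\mathbf{x}_{t-1}-\eta_t(\nabla f(\mathbf{x}^{\mathrm{md}}_{t-1};\xi_{t-\frac12})+\nabla_{\mathbf{x}}h(\mathbf{x}_{t-\frac12},\mathbf{y}_{t-\frac12};\zeta_t))$, $\mathbf{y}_t=\mathbf{y}_{t-1}-\frac{\eta_t}{\mathcal{R}}(-\nabla_{\mathbf{y}}h(\mathbf{x}_{t-\frac12},\mathbf{y}_{t-\frac12};\zeta_t)+\nabla g(\mathbf{y}^{\mathrm{md}}_{t-1};\xi_{t-\frac12}))$, $\mathbf{x}^{\mathrm{md}}_t=(1-\alpha_{t+1})\mathbf{x}^{\mathrm{ag}}_{t-\frac12}+\alpha_{t+1}\mathbf{x}_t$, $\ \mathbf{y}^{\mathrm{md}}_t=(1-\alpha_{t+1})\mathbf{y}^{\mathrm{ag}}_{t-\frac12}+\alpha_{t+1}\mathbf{y}_t$.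 The output is $[\mathbf{x}^{\mathrm{ag}}_{\mathscr{T}-\frac12};\mathbf{y}^{\mathrm{ag}}_{\mathscr{T}-\frac12}]$. *)

theory Defs
  imports "HOL-Probability.Probability"
begin

definition grad :: "('a::real_inner \<Rightarrow> real) \<Rightarrow> 'a \<Rightarrow> 'a" where
  "grad f x = (THE D. GDERIV f x :> D)"

lemma grad_eqI: "grad f x = D" if "GDERIV f x :> D"
  unfolding grad_def
proof (rule the_equality)
  fix D' assume "GDERIV f x :> D'"
  then have "(\<lambda>h. h \<bullet> D') = (\<lambda>h. h \<bullet> D)"
    using that unfolding gderiv_def by (rule has_derivative_unique)
  then have "h \<bullet> D' = h \<bullet> D" for h
    by (rule fun_cong)
  from this [of "D' - D"] have "(D' - D) \<bullet> (D' - D) = 0"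
    by (simp add: inner_diff_right)
  then show "D' = D"
    by simp
qed (rule that)

definition smooth_strongly_convex :: "real \<Rightarrow> real \<Rightarrow> ('a::real_inner \<Rightarrow> real) \<Rightarrow> bool" where
  "smooth_strongly_convex \<mu> L F \<longleftrightarrow>
     (\<forall>x. F differentiable (at x)) \<and>
     (\<forall>x x'. \<mu> / 2 * (norm (x - x'))\<^sup>2 \<le> F x - F x' - grad F x' \<bullet> (x - x') \<and>
             F x - F x' - grad F x' \<bullet> (x - x') \<le> L / 2 * (norm (x - x'))\<^sup>2)"

definition saddle_point :: "('a \<Rightarrow> 'b \<Rightarrow> real) \<Rightarrow> 'a \<Rightarrow> 'b \<Rightarrow> bool" where
  "saddle_point \<Phi> wx wy \<longleftrightarrow> (\<forall>x y. \<Phi> wx y \<le> \<Phi> wx wy \<and> \<Phi> wx wy \<le> \<Phi> x wy)"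

definition lambda_max :: "real^'k^'k \<Rightarrow> real" where
  "lambda_max A = (GREATEST l. \<exists>v. v \<noteq> 0 \<and> A *v v = l *\<^sub>R v)"

text \<open>The coupling \<open>H\<close>. Note that \<open>real^'m^'n\<close> is the type of matrices with rows indexed by
  \<open>'n\<close> and columns by \<open>'m\<close>.\<close>

definition coupling :: "real^'m^'n \<Rightarrow> real^'n \<Rightarrow> real^'m \<Rightarrow> real^'n \<Rightarrow> real^'m \<Rightarrow> real" where
  "coupling B ux uy x y = x \<bullet> (B *v y) - x \<bullet> ux + uy \<bullet> y"

lemma grad_coupling:
  fixes B :: "real^'m^'n"
  shows "grad (\<lambda>x. coupling B ux uy x y) x = B *v y - ux"
    and "grad (\<lambda>y. coupling B ux uy x y) y = transpose B *v x + uy"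
proof -
  show "grad (\<lambda>x. coupling B ux uy x y) x = B *v y - ux"
    unfolding coupling_def
    by (rule grad_eqI)
       (auto simp: gderiv_def inner_diff_right intro!: derivative_eq_intros)
  have "x \<bullet> (B *v z) = z \<bullet> (transpose B *v x)" for z
    by (simp add: dot_lmul_matrix [symmetric] transpose_matrix_vector inner_commute)
  then have "coupling B ux uy x = (\<lambda>y. y \<bullet> (transpose B *v x) - x \<bullet> ux + y \<bullet> uy)"
    by (simp add: fun_eq_iff coupling_def inner_commute)
  then show "grad (\<lambda>y. coupling B ux uy x y) y = transpose B *v x + uy"
    by (intro grad_eqI)
       (auto simp: gderiv_def inner_add_right intro!: derivative_eq_intros)
qed

text \<open>Joint measurability in the query point and the sample makes the oracle answers at random
  query points random variables.\<close>

definition unbiased_oracle ::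
    "'s measure \<Rightarrow> ('a::topological_space \<Rightarrow> 's \<Rightarrow> 'b::euclidean_space) \<Rightarrow> ('a \<Rightarrow> 'b) \<Rightarrow> bool" where
  "unbiased_oracle D g g' \<longleftrightarrow>
     (\<lambda>(z, s). g z s) \<in> borel_measurable (borel \<Otimes>\<^sub>M D) \<and>
     (\<forall>z. integrable D (g z) \<and> (\<integral>s. g z s \<partial>D) = g' z)"

text \<open>\<open>mean_le D X c\<close>: the expectation of \<open>X\<close> exists, is finite, and is at most \<open>c\<close>.
  (The Bochner integral of a non-integrable function is \<open>0\<close> by convention.)\<close>

definition mean_le :: "'s measure \<Rightarrow> ('s \<Rightarrow> real) \<Rightarrow> real \<Rightarrow> bool" where
  "mean_le D X c \<longleftrightarrow> integrable D X \<and> (\<integral>s. X s \<partial>D) \<le> c"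

text \<open>One trajectory of the AG-EG algorithm. The state after \<open>t\<close> steps consists of
  \<open>x\<^sub>t, y\<^sub>t\<close> (\<open>itx, ity\<close>), the aggregated iterates of index \<open>t - 1/2\<close> (\<open>agx, agy\<close>) and
  \<open>x\<^sup>m\<^sup>d\<^sub>t, y\<^sup>m\<^sup>d\<^sub>t\<close> (\<open>mdx, mdy\<close>). In step \<open>t\<close> the samples \<open>\<xi> t\<close>, \<open>\<zeta>h t\<close>, \<open>\<zeta> t\<close>
  are those of index \<open>t - 1/2\<close>, \<open>t - 1/2\<close> and \<open>t\<close>.\<close>

record ('a, 'b) ag_eg_state =
  itx :: 'a
  ity :: 'b
  agx :: 'a
  agy :: 'b
  mdx :: 'a
  mdy :: 'b

primrec ag_eg ::
    "(nat \<Rightarrow> real) \<Rightarrow> (nat \<Rightarrow> real) \<Rightarrow> real \<Rightarrow>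
     ('a::real_vector \<Rightarrow> 's \<Rightarrow> 'a) \<Rightarrow> ('b::real_vector \<Rightarrow> 's \<Rightarrow> 'b) \<Rightarrow>
     ('a \<Rightarrow> 'b \<Rightarrow> 'z \<Rightarrow> 'a) \<Rightarrow> ('a \<Rightarrow> 'b \<Rightarrow> 'z \<Rightarrow> 'b) \<Rightarrow>
     'a \<Rightarrow> 'b \<Rightarrow> (nat \<Rightarrow> 's) \<Rightarrow> (nat \<Rightarrow> 'z) \<Rightarrow> (nat \<Rightarrow> 'z) \<Rightarrow> nat \<Rightarrow> ('a, 'b) ag_eg_state" where
  "ag_eg \<alpha> \<eta> R gf gg hx hy x0 y0 \<xi> \<zeta>h \<zeta> 0 =
     \<lparr>itx = x0, ity = y0, agx = x0, agy = y0, mdx = x0, mdy = y0\<rparr>"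
| "ag_eg \<alpha> \<eta> R gf gg hx hy x0 y0 \<xi> \<zeta>h \<zeta> (Suc s) =
     (let S = ag_eg \<alpha> \<eta> R gf gg hx hy x0 y0 \<xi> \<zeta>h \<zeta> s;
          t = Suc s;
          xh = itx S - \<eta> t *\<^sub>R (gf (mdx S) (\<xi> t) + hx (itx S) (ity S) (\<zeta>h t));
          yh = ity S - (\<eta> t / R) *\<^sub>R (- hy (itx S) (ity S) (\<zeta>h t) + gg (mdy S) (\<xi> t));
          xag = (1 - \<alpha> t) *\<^sub>R agx S + \<alpha> t *\<^sub>R xh;
          yag = (1 - \<alpha> t) *\<^sub>R agy S + \<alpha> t *\<^sub>R yh;
          x = itx S - \<eta> t *\<^sub>R (gf (mdx S) (\<xi> t) + hx xh yh (\<zeta> t));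
          y = ity S - (\<eta> t / R) *\<^sub>R (- hy xh yh (\<zeta> t) + gg (mdy S) (\<xi> t))
      in \<lparr>itx = x, ity = y, agx = xag, agy = yag,
          mdx = (1 - \<alpha> (t + 1)) *\<^sub>R xag + \<alpha> (t + 1) *\<^sub>R x,
          mdy = (1 - \<alpha> (t + 1)) *\<^sub>R yag + \<alpha> (t + 1) *\<^sub>R y\<rparr>)"

text \<open>\<open>prob_space.indep_vars\<close> requires a common codomain, so mutual independence of the
  initialization and the samples of steps \<open>1, \<dots>, T\<close> is stated for the sigma-algebras they
  generate, indexed by the following type.\<close>

datatype source = Init | Xi nat | Zeta_half nat | Zeta nat

definition independent_sampling ::
    "'w measure \<Rightarrow> 's measure \<Rightarrow> 'z measure \<Rightarrow> nat \<Rightarrow>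
     ('w \<Rightarrow> 'a::topological_space) \<Rightarrow> ('w \<Rightarrow> 'b::topological_space) \<Rightarrow>
     (nat \<Rightarrow> 'w \<Rightarrow> 's) \<Rightarrow> (nat \<Rightarrow> 'w \<Rightarrow> 'z) \<Rightarrow> (nat \<Rightarrow> 'w \<Rightarrow> 'z) \<Rightarrow> bool" where
  "independent_sampling M D\<xi> D\<zeta> T x0 y0 \<xi> \<zeta>h \<zeta> \<longleftrightarrow>
     (\<forall>t\<in>{1..T}.
        \<xi> t \<in> measurable M D\<xi> \<and> distr M D\<xi> (\<xi> t) = D\<xi> \<and>
        \<zeta>h t \<in> measurable M D\<zeta> \<and> distr M D\<zeta> (\<zeta>h t) = D\<zeta> \<and>
        \<zeta> t \<in> measurable M D\<zeta> \<and> distr M D\<zeta> (\<zeta> t) = D\<zeta>) \<and>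
     prob_space.indep_sets M
       (\<lambda>i. case i of
              Init \<Rightarrow> sets (vimage_algebra (space M) (\<lambda>w. (x0 w, y0 w)) borel)
            | Xi t \<Rightarrow> sets (vimage_algebra (space M) (\<xi> t) D\<xi>)
            | Zeta_half t \<Rightarrow> sets (vimage_algebra (space M) (\<zeta>h t) D\<zeta>)
            | Zeta t \<Rightarrow> sets (vimage_algebra (space M) (\<zeta> t) D\<zeta>))
       ({Init} \<union> Xi ` {1..T} \<union> Zeta_half ` {1..T} \<union> Zeta ` {1..T})"

definition eta_bar ::
    "real \<Rightarrow> real \<Rightarrow> real \<Rightarrow> nat \<Rightarrow> real \<Rightarrow> real \<Rightarrow> real \<Rightarrow> real \<Rightarrow> nat \<Rightarrow> real" where
  "eta_bar L_Str L_Bil D0 T C r \<beta> s t =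
     real t /
       (max (2 / r * L_Str) (s * sqrt (real T * (real T + 1)\<^sup>2) / (C * D0))
        + sqrt ((1 + \<beta>) / r) * L_Bil * real t)"

definition prefactor ::
    "real \<Rightarrow> real \<Rightarrow> real \<Rightarrow> nat \<Rightarrow> real \<Rightarrow> real \<Rightarrow> real \<Rightarrow> real \<Rightarrow> real" where
  "prefactor L_Str L_Bil D0 T C r \<beta> s =
     1 + C * s * sqrt (real T * (real T + 1)\<^sup>2)
           / (1 / eta_bar L_Str L_Bil D0 T C r \<beta> s 1 * D0)"

end

theory Submission
  imports Defs
begin

text \<open>Write \<open>p = (x, c *\<^sub>R y)\<close> with \<open>c\<^sup>2 = R\<close>. Then the strongly convex part has a gradient \<open>g\<close>, the bilinear
  part a skew, \<open>L_Bil\<close>-Lipschitz field \<open>h\<close>, and the saddle point is the zero \<open>w\<close> of \<open>g + h\<close>.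
  Nesterov's estimate for \<open>gap p = f p - f w - g w \<bullet> (p - w)\<close> at the aggregated iterates and the
  extragradient identity for the distance to \<open>w\<close> combine, in expectation, to
  \<open>D t + \<eta> t * (t + 1) * V t \<le> D (t - 1) + \<eta> t * (t - 1) * V (t - 1) + 3 * \<sigma>\<^sup>2 * (\<eta> t)\<^sup>2\<close>,
  where \<open>D t\<close> is the mean squared distance and \<open>V t\<close> the mean gap. Since \<open>\<eta> t / t\<close> decreases, this
  telescopes; the noise sum is at most \<open>\<sigma>\<^sup>2 * T * (T + 1)\<^sup>2 * (\<eta> 1)\<^sup>2\<close>, and the step size is chosen
  so that this is at most \<open>C\<^sup>2 * D0\<^sup>2\<close>.\<close>

section \<open>Noise and square integrable random variables\<close>

text \<open>The sample \<open>\<xi>\<close> of a step drives both the half step and the full step,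
  so its noise \<open>\<delta>\<close> is correlated with \<open>zh\<close> and has mean zero only
  against \<open>z - w\<close>. The remaining \<open>\<delta> \<bullet> (zh - z)\<close> is paid
  from the term \<open>- (norm (zh - z))^2\<close> of the extragradient identity: smoothness and
  coupling may use the fraction \<open>r\<close> of it, the noise takes \<open>1 - r\<close>, hence
  the factor \<open>1 / (1 - r)\<close> in \<open>\<sigma>\<close>. In the same way
  \<open>\<beta>\<close> separates \<open>h zh - h z\<close> from the coupling noise of the half
  step, at cost \<open>1 + 1 / \<beta>\<close>; the full step adds 1. The factor
  \<open>1 / sqrt 3\<close> is matched to the bound \<open>T * (T + 1)^2 / 3\<close> for a sum of
  squares. The oracles are queried at random points. Mean zero is transferred to these by Fubini on
  the joint law of the past and the fresh sample, which asks for integrability of every cross term;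
  therefore square integrability of all iterates is carried along. Each step has two sigma-algebras,
  one for each of its two rounds of sampling.\<close>

context prob_space
begin

text \<open>Independence gives the product formula on rectangles, and these determine the joint law.
  Independence is stated for a whole sub-sigma-algebra, so that one hypothesis serves every
  \<open>A\<close>-measurable \<open>X\<close>, with any codomain.\<close>

lemma distr_pair_indep_subalgebra:
  assumes A: "subalgebra M A" and X: "X \<in> measurable A N" and Y: "Y \<in> measurable M D"
    and indep: "indep_set (sets A) (sets (vimage_algebra (space M) Y D))"
  shows "distr M (N \<Otimes>\<^sub>M D) (\<lambda>w. (X w, Y w)) = distr M N X \<Otimes>\<^sub>M distr M D Y"
proof -
  note emeasure_eq = emeasure_eq_measure and prod = indep_setD[OF indep]
  have sp: "space A = space M"
    using A by (auto simp: subalgebra_def)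
  have XM: "X \<in> measurable M N"
    using A X by (rule measurable_from_subalg)
  interpret X: prob_space "distr M N X" by (rule prob_space_distr[OF XM])
  interpret Y: prob_space "distr M D Y" by (rule prob_space_distr[OF Y])
  interpret pair_prob_space "distr M N X" "distr M D Y" ..
  show ?thesis
  proof (rule pair_measure_eqI[symmetric])
    fix S S' assume "S \<in> sets (distr M N X)" "S' \<in> sets (distr M D Y)"
    then have S: "S \<in> sets N" and S': "S' \<in> sets D" by auto
    have "X -` S \<inter> space M \<in> sets A"
      using measurable_sets[OF X S] by (simp add: sp)
    moreover have "Y -` S' \<inter> space M \<in> sets (vimage_algebra (space M) Y D)"
      using S' by (rule in_vimage_algebra)
    ultimately have "measure M ((X -` S \<inter> space M) \<inter> (Y -` S' \<inter> space M)) =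
        measure M (X -` S \<inter> space M) * measure M (Y -` S' \<inter> space M)"
      by (rule prod)
    moreover have "(\<lambda>w. (X w, Y w)) -` (S \<times> S') \<inter> space M = (X -` S \<inter> space M) \<inter> (Y -` S' \<inter> space M)"
      by auto
    ultimately show "emeasure (distr M N X) S * emeasure (distr M D Y) S' =
        emeasure (distr M (N \<Otimes>\<^sub>M D) (\<lambda>w. (X w, Y w))) (S \<times> S')"
      using XM Y S S' by (simp add: emeasure_distr emeasure_eq ennreal_mult')
  qed (auto intro: X.sigma_finite_measure_axioms Y.sigma_finite_measure_axioms)
qed

text \<open>Tonelli under the product law: with \<open>x\<close> frozen the inner integral is at
  most \<open>c\<close>. The nonnegative integral is used because integrability is part of the
  conclusion.\<close>

lemma noise_second_moment:
  fixes N :: "'b measure" and D :: "'s measure" and \<phi> :: "'b \<Rightarrow> 's \<Rightarrow> 'c::euclidean_space"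
  assumes D: "prob_space D" and X[measurable]: "X \<in> measurable M N" and Y[measurable]: "Y \<in> measurable M D"
    and law: "distr M (N \<Otimes>\<^sub>M D) (\<lambda>w. (X w, Y w)) = distr M N X \<Otimes>\<^sub>M D"
    and \<phi>: "(\<lambda>(x, s). \<phi> x s) \<in> borel_measurable (N \<Otimes>\<^sub>M D)"
    and var: "\<And>x. mean_le D (\<lambda>s. (norm (\<phi> x s))\<^sup>2) c"
  shows "mean_le M (\<lambda>w. (norm (\<phi> (X w) (Y w)))\<^sup>2) c"
proof -
  interpret D: prob_space D by (rule D)
  note [measurable] = \<phi>
  have m: "(\<lambda>w. \<phi> (X w) (Y w)) \<in> borel_measurable M"
    using measurable_compose[OF measurable_Pair[OF X Y] \<phi>] by simp
  \<comment> \<open>\<open>ennreal\<close> sends negative numbers to 0, so \<open>0 \<le> c\<close>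
    is what allows the final bound to be read back in the reals. Any point would do for the
    instance.\<close>
  have c: "0 \<le> c" using var[of undefined] unfolding mean_le_def
    by (smt (verit) Bochner_Integration.integral_nonneg zero_le_power2)
  have "(\<integral>\<^sup>+w. ennreal ((norm (\<phi> (X w) (Y w)))\<^sup>2) \<partial>M) =
     (\<integral>\<^sup>+p. ennreal ((norm (\<phi> (fst p) (snd p)))\<^sup>2) \<partial>distr M (N \<Otimes>\<^sub>M D) (\<lambda>w. (X w, Y w)))"
    using \<phi> by (subst nn_integral_distr) (auto simp: case_prod_unfold)
  also have "\<dots> = (\<integral>\<^sup>+x. \<integral>\<^sup>+s. ennreal ((norm (\<phi> x s))\<^sup>2) \<partial>D \<partial>distr M N X)"
    using \<phi> unfolding law
    by (subst D.nn_integral_fst[symmetric]) (auto simp: case_prod_unfold)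
  also have "\<dots> \<le> (\<integral>\<^sup>+x. ennreal c \<partial>distr M N X)"
  proof (rule nn_integral_mono)
    fix x
    show "(\<integral>\<^sup>+s. ennreal ((norm (\<phi> x s))\<^sup>2) \<partial>D) \<le> ennreal c"
      using var[of x] unfolding mean_le_def
      by (subst nn_integral_eq_integral) (auto intro: ennreal_leI)
  qed
  also have "\<dots> = ennreal c"
    using prob_space.emeasure_space_1[OF prob_space_distr[OF X]] by simp
  finally have le: "(\<integral>\<^sup>+w. ennreal ((norm (\<phi> (X w) (Y w)))\<^sup>2) \<partial>M) \<le> ennreal c" .
  then have int: "integrable M (\<lambda>w. (norm (\<phi> (X w) (Y w)))\<^sup>2)"
    using m by (intro integrableI_bounded) (auto simp: le_less_trans)
  moreover have "(\<integral>w. (norm (\<phi> (X w) (Y w)))\<^sup>2 \<partial>M) \<le> c"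
    using le c by (simp add: nn_integral_eq_integral[OF int])
  ultimately show ?thesis by (simp add: mean_le_def)
qed

text \<open>Fubini: with \<open>x\<close> frozen, \<open>\<psi> x\<close> leaves the inner integral,
  and the mean of \<open>\<phi> x\<close> is zero. Both functions take the same argument
  \<open>X\<close>, which must therefore contain all that the test vector depends on.\<close>

lemma noise_orthogonal:
  fixes N :: "'b measure" and D :: "'s measure" and \<phi> :: "'b \<Rightarrow> 's \<Rightarrow> 'c::euclidean_space"
  assumes D: "prob_space D" and X[measurable]: "X \<in> measurable M N" and Y[measurable]: "Y \<in> measurable M D"
    and law: "distr M (N \<Otimes>\<^sub>M D) (\<lambda>w. (X w, Y w)) = distr M N X \<Otimes>\<^sub>M D"
    and \<phi>: "(\<lambda>(x, s). \<phi> x s) \<in> borel_measurable (N \<Otimes>\<^sub>M D)"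
    and mean: "\<And>x. integrable D (\<phi> x)" "\<And>x. (\<integral>s. \<phi> x s \<partial>D) = 0"
    and \<psi>[measurable]: "\<psi> \<in> borel_measurable N"
    and int: "integrable M (\<lambda>w. \<phi> (X w) (Y w) \<bullet> \<psi> (X w))"
  shows "(\<integral>w. \<phi> (X w) (Y w) \<bullet> \<psi> (X w) \<partial>M) = 0"
proof -
  interpret D: prob_space D by (rule D)
  interpret X: prob_space "distr M N X" by (rule prob_space_distr[OF X])
  interpret pair_sigma_finite "distr M N X" D ..
  let ?F = "\<lambda>p. \<phi> (fst p) (snd p) \<bullet> \<psi> (fst p)"
  have m[measurable]: "?F \<in> borel_measurable (N \<Otimes>\<^sub>M D)"
    using \<phi> by (auto simp: case_prod_unfold)
  have "integrable (distr M (N \<Otimes>\<^sub>M D) (\<lambda>w. (X w, Y w))) ?F"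
    using int by (subst integrable_distr_eq) auto
  then have int': "integrable (distr M N X \<Otimes>\<^sub>M D) ?F"
    unfolding law .
  have "(\<integral>w. \<phi> (X w) (Y w) \<bullet> \<psi> (X w) \<partial>M) = (\<integral>p. ?F p \<partial>distr M (N \<Otimes>\<^sub>M D) (\<lambda>w. (X w, Y w)))"
    by (subst integral_distr) auto
  also have "\<dots> = (\<integral>x. \<integral>s. ?F (x, s) \<partial>D \<partial>distr M N X)"
    unfolding law by (rule integral_fst'[OF int', symmetric])
  also have "\<dots> = 0"
    using mean by (simp add: integral_inner_left)
  finally show ?thesis .
qed

end

section \<open>Square integrable random vectors and their closure properties\<close>

definition square_integrable :: "'w measure \<Rightarrow> ('w \<Rightarrow> 'a::euclidean_space) \<Rightarrow> bool" where
  "square_integrable M X \<longleftrightarrow> X \<in> borel_measurable M \<and> integrable M (\<lambda>w. (norm (X w))\<^sup>2)"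

lemma square_integrable_bounded:
  assumes Y: "square_integrable M Y" and X: "X \<in> borel_measurable M"
    and le: "\<And>w. norm (X w) \<le> c * norm (Y w)"
  shows "square_integrable M X"
  unfolding square_integrable_def
proof (intro conjI X)
  have "(norm (X w))\<^sup>2 \<le> c\<^sup>2 * (norm (Y w))\<^sup>2" for w
    using power_mono[OF le, of w 2] by (simp add: power_mult_distrib)
  then have bound: "AE w in M. norm ((norm (X w))\<^sup>2) \<le> norm (c\<^sup>2 * (norm (Y w))\<^sup>2)"
    by simp
  show "integrable M (\<lambda>w. (norm (X w))\<^sup>2)"
    by (rule Bochner_Integration.integrable_bound[OF _ _ bound])
      (use Y X in \<open>auto simp: square_integrable_def\<close>)
qed

lemma square_integrable_add:
  assumes "square_integrable M X" "square_integrable M Y"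
  shows "square_integrable M (\<lambda>w. X w + Y w)"
  unfolding square_integrable_def
proof (intro conjI)
  show m: "(\<lambda>w. X w + Y w) \<in> borel_measurable M"
    using assms by (auto simp: square_integrable_def)
  have "(norm (x + y))\<^sup>2 \<le> 2 * (norm x)\<^sup>2 + 2 * (norm y)\<^sup>2" for x y :: 'b
    using zero_le_power2[of "norm (x - y)"] by (simp add: power2_norm_eq_inner algebra_simps inner_commute)
  then have bound: "AE w in M. norm ((norm (X w + Y w))\<^sup>2) \<le> norm (2 * (norm (X w))\<^sup>2 + 2 * (norm (Y w))\<^sup>2)"
    by simp
  show "integrable M (\<lambda>w. (norm (X w + Y w))\<^sup>2)"
    by (rule Bochner_Integration.integrable_bound[OF _ _ bound])
      (use assms m in \<open>auto simp: square_integrable_def\<close>)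
qed

lemma square_integrable_scaleR:
  "square_integrable M X \<Longrightarrow> square_integrable M (\<lambda>w. c *\<^sub>R X w)"
  by (rule square_integrable_bounded[where c="\<bar>c\<bar>"]) (auto simp: square_integrable_def)

lemma square_integrable_diff:
  "square_integrable M X \<Longrightarrow> square_integrable M Y \<Longrightarrow> square_integrable M (\<lambda>w. X w - Y w)"
  using square_integrable_add[of M X "\<lambda>w. (-1) *\<^sub>R Y w"] square_integrable_scaleR[of M Y "-1"] by simp

lemma (in finite_measure) square_integrable_const: "square_integrable M (\<lambda>w. c)"
  by (simp add: square_integrable_def)

text \<open>A Lipschitz map grows at most affinely: \<open>h (X w) - h 0\<close> is dominated by
  \<open>K * norm (X w)\<close>, and the constant \<open>h 0\<close> is harmless on a finite
  measure.\<close>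

lemma (in finite_measure) square_integrable_Lipschitz:
  assumes "square_integrable M X" "h \<in> borel_measurable borel"
    and lip: "\<And>x y. norm (h x - h y) \<le> K * norm (x - y)"
  shows "square_integrable M (\<lambda>w. h (X w))"
proof -
  have "(\<lambda>w. h (X w) - h 0) \<in> borel_measurable M"
    using assms by (auto simp: square_integrable_def)
  then have "square_integrable M (\<lambda>w. h (X w) - h 0)"
    using lip[of _ 0] by (intro square_integrable_bounded[OF assms(1), where c=K]) auto
  from square_integrable_add[OF this square_integrable_const[of "h 0"]] show ?thesis by simp
qed

lemma integrable_inner_square:
  assumes "square_integrable M X" "square_integrable M Y"
  shows "integrable M (\<lambda>w. X w \<bullet> Y w)"
proof -
  have "\<bar>x \<bullet> y\<bar> \<le> (norm x)\<^sup>2 + (norm y)\<^sup>2" for x y :: 'b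
  proof -
    have "0 \<le> (norm x - norm y)\<^sup>2" "0 \<le> (norm x)\<^sup>2 + (norm y)\<^sup>2" by auto
    then show ?thesis using Cauchy_Schwarz_ineq2[of x y] by (simp add: power2_eq_square algebra_simps)
  qed
  then have bound: "AE w in M. norm (X w \<bullet> Y w) \<le> norm ((norm (X w))\<^sup>2 + (norm (Y w))\<^sup>2)"
    by simp
  show ?thesis
    by (rule Bochner_Integration.integrable_bound[OF _ _ bound])
      (use assms in \<open>auto simp: square_integrable_def\<close>)
qed

lemma borel_measurable_Lipschitz:
  fixes h :: "'a::euclidean_space \<Rightarrow> 'b::euclidean_space"
  assumes "\<And>x y. norm (h x - h y) \<le> K * norm (x - y)"
  shows "h \<in> borel_measurable borel"
proof -
  have "(\<bar>K\<bar>)-lipschitz_on UNIV h"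
  proof (rule lipschitz_onI)
    fix x y show "dist (h x) (h y) \<le> \<bar>K\<bar> * dist x y"
      using assms[of x y] mult_right_mono[OF abs_ge_self[of K] norm_ge_zero[of "x - y"]] by (simp add: dist_norm)
  qed simp
  then show ?thesis
    by (intro borel_measurable_continuous_onI lipschitz_on_continuous_on)
qed

section \<open>One step of the extragradient method with momentum\<close>

text \<open>The deterministic setting after the two blocks are merged into one vector.
  \<open>g\<close> plays the gradient of \<open>f\<close>, but enters only through the two quadratic
  bounds; \<open>root\<close> is the first-order condition of the saddle point.\<close>

locale skew_composite =
  fixes f :: "'a::euclidean_space \<Rightarrow> real" and g h :: "'a \<Rightarrow> 'a" and \<mu> L K :: real and w :: 'a
  assumes strong: "\<And>x x'. \<mu> / 2 * (norm (x - x'))\<^sup>2 \<le> f x - f x' - g x' \<bullet> (x - x')"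
    and smooth: "\<And>x x'. f x - f x' - g x' \<bullet> (x - x') \<le> L / 2 * (norm (x - x'))\<^sup>2"
    and \<mu>_pos: "\<mu> > 0"
    and skew: "\<And>x x'. (h x - h x') \<bullet> (x - x') = 0"
    and h_Lipschitz: "\<And>x x'. norm (h x - h x') \<le> K * norm (x - x')"
    and f_measurable: "f \<in> borel_measurable borel"
    and root: "g w + h w = 0"
begin

text \<open>The Bregman divergence of \<open>f\<close> from the solution \<open>w\<close>. It lies
  between two multiples of the squared distance to \<open>w\<close>: the upper one makes it
  integrable, the lower one yields the final estimate.\<close>

definition gap :: "'a \<Rightarrow> real" where
  "gap x = f x - f w - g w \<bullet> (x - w)"

lemma gap_ge: "\<mu> / 2 * (norm (x - w))\<^sup>2 \<le> gap x"
  using strong[of x w] by (simp add: gap_def)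

lemma gap_le: "gap x \<le> L / 2 * (norm (x - w))\<^sup>2"
  using smooth[of x w] by (simp add: gap_def)

lemma gap_nonneg: "0 \<le> gap x"
  using gap_ge[of x] \<mu>_pos by (smt (verit) mult_nonneg_nonneg zero_le_power2 half_gt_zero)

lemma \<mu>_le_L: "\<mu> \<le> L"
proof -
  obtain b :: 'a where "b \<in> Basis" using nonempty_Basis by blast
  then show ?thesis
    using strong[of b 0] smooth[of b 0] by (simp add: norm_Basis)
qed

lemma L_pos: "L > 0"
  using \<mu>_le_L \<mu>_pos by simp

text \<open>Tilting \<open>f\<close> by a linear function gives \<open>\<phi>\<close>, which is
  minimal at \<open>x'\<close>. One gradient step of length \<open>1 / L\<close> from
  \<open>x\<close> lowers \<open>\<phi>\<close> by at least \<open>(norm v)^2 / (2 * L)\<close>, so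
  this is at most \<open>\<phi> x - \<phi> x'\<close>, which \<open>smooth\<close> bounds in turn.
  The result serves measurability and square integrability of \<open>g\<close> along the
  iterates.\<close>

lemma g_Lipschitz: "norm (g x - g x') \<le> L * norm (x - x')"
proof -
  define \<phi> where "\<phi> z = f z - g x' \<bullet> z" for z
  define v where "v = g x - g x'"
  let ?z = "x - (1 / L) *\<^sub>R v"
  have "0 \<le> \<mu> / 2 * (norm (?z - x'))\<^sup>2" using \<mu>_pos by simp
  then have "g x' \<bullet> (?z - x') \<le> f ?z - f x'"
    using strong[of ?z x'] by linarith
  then have 1: "\<phi> x' \<le> \<phi> ?z"
    by (simp add: \<phi>_def inner_diff_right)
  have "(norm (?z - x))\<^sup>2 = (norm v)\<^sup>2 / L\<^sup>2"
    using L_pos by (simp add: power_divide)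
  then have "L / 2 * (norm (?z - x))\<^sup>2 = (norm v)\<^sup>2 / (2 * L)"
    using L_pos by (simp add: power2_eq_square)
  moreover have "(g x - g x') \<bullet> v / L = (norm v)\<^sup>2 / L"
    by (simp add: v_def power2_norm_eq_inner)
  ultimately have "\<phi> ?z \<le> \<phi> x - (norm v)\<^sup>2 / L + (norm v)\<^sup>2 / (2 * L)"
    using smooth[of ?z x] by (simp add: \<phi>_def inner_diff_right inner_diff_left diff_divide_distrib)
  with 1 have "(norm v)\<^sup>2 / (2 * L) \<le> \<phi> x - \<phi> x'" by simp
  also have "\<dots> \<le> L / 2 * (norm (x - x'))\<^sup>2"
    using smooth[of x x'] by (simp add: \<phi>_def inner_diff_right)
  finally have "(norm v)\<^sup>2 \<le> (L / 2 * (norm (x - x'))\<^sup>2) * (2 * L)"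
    using L_pos by (simp only: pos_divide_le_eq)
  also have "\<dots> = (L * norm (x - x'))\<^sup>2"
    by (simp add: power2_eq_square)
  finally have "(norm v)\<^sup>2 \<le> (L * norm (x - x'))\<^sup>2" .
  moreover have "0 \<le> L * norm (x - x')" using L_pos by simp
  ultimately show ?thesis
    unfolding v_def by (rule power2_le_imp_le)
qed

text \<open>The optimality condition and skewness of \<open>h\<close> turn the linear part of the gap into the
  full operator \<open>g md + h zh\<close>.\<close>

lemma gap_momentum:
  assumes \<alpha>: "0 \<le> \<alpha>" "\<alpha> \<le> 1"
    and md: "md = (1 - \<alpha>) *\<^sub>R ag + \<alpha> *\<^sub>R z" and ag': "ag' = (1 - \<alpha>) *\<^sub>R ag + \<alpha> *\<^sub>R zh"
  shows "gap ag' \<le> (1 - \<alpha>) * gap ag + \<alpha> * ((g md + h zh) \<bullet> (zh - w)) + L * \<alpha>\<^sup>2 / 2 * (norm (zh - z))\<^sup>2"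
proof -
  have low: "f md + g md \<bullet> (x - md) \<le> f x" for x
  proof -
    have "0 \<le> \<mu> / 2 * (norm (x - md))\<^sup>2" using \<mu>_pos by simp
    then show ?thesis using strong[of x md] by linarith
  qed
  \<comment> \<open>Both points use the same \<open>ag\<close> with the same weight, so it cancels.
    The factor \<open>\<alpha>^2\<close> in front of the smoothness error comes from here.\<close>
  have "ag' - md = \<alpha> *\<^sub>R (zh - z)"
    by (simp add: md ag' algebra_simps)
  then have "f ag' \<le> f md + g md \<bullet> (ag' - md) + L * \<alpha>\<^sup>2 / 2 * (norm (zh - z))\<^sup>2"
    using smooth[of ag' md] by (simp add: power_mult_distrib)
  \<comment> \<open>The part \<open>zh - md\<close> is routed through \<open>w\<close>, so that the
    convexity bound \<open>low\<close> can be applied at \<open>ag\<close> and at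
    \<open>w\<close>.\<close>
  also have "g md \<bullet> (ag' - md) = (1 - \<alpha>) * (g md \<bullet> (ag - md)) + \<alpha> * (g md \<bullet> (w - md)) + \<alpha> * (g md \<bullet> (zh - w))"
    by (simp add: ag' algebra_simps)
  finally have "f ag' \<le> (1 - \<alpha>) * (f md + g md \<bullet> (ag - md)) + \<alpha> * (f md + g md \<bullet> (w - md))
      + \<alpha> * (g md \<bullet> (zh - w)) + L * \<alpha>\<^sup>2 / 2 * (norm (zh - z))\<^sup>2"
    by (simp add: algebra_simps)
  also have "\<dots> \<le> (1 - \<alpha>) * f ag + \<alpha> * f w
      + \<alpha> * (g md \<bullet> (zh - w)) + L * \<alpha>\<^sup>2 / 2 * (norm (zh - z))\<^sup>2"
    using \<alpha> mult_left_mono[OF low[of ag], of "1 - \<alpha>"] mult_left_mono[OF low[of w], of \<alpha>] by simp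
  finally have 1: "f ag' \<le> (1 - \<alpha>) * f ag + \<alpha> * f w
      + \<alpha> * (g md \<bullet> (zh - w)) + L * \<alpha>\<^sup>2 / 2 * (norm (zh - z))\<^sup>2" .
  have gw: "g w = - h w" using root by (simp add: eq_neg_iff_add_eq_0)
  have 2: "- (g w \<bullet> (zh - w)) = h zh \<bullet> (zh - w)"
    using skew[of zh w] by (simp add: gw inner_diff_left)
  have 3: "g w \<bullet> (ag' - w) = (1 - \<alpha>) * (g w \<bullet> (ag - w)) + \<alpha> * (g w \<bullet> (zh - w))"
    by (simp add: ag' algebra_simps)
  have "\<alpha> * - (g w \<bullet> (zh - w)) = \<alpha> * (h zh \<bullet> (zh - w))"
    using 2 by (rule arg_cong)
  then show ?thesis
    unfolding gap_def 3 inner_add_left using 1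
    unfolding distrib_left distrib_right right_diff_distrib left_diff_distrib by linarith
qed

end

text \<open>Both steps start at \<open>z\<close>. Expanding the distance after the full step
  produces \<open>(norm q)^2 - 2 * (q \<bullet> p)\<close>; completing this square leaves
  \<open>(norm (q - p))^2 - (norm p)^2\<close>, and \<open>p = z - zh\<close>.\<close>

lemma extragradient_identity:
  fixes z :: "'a::real_inner"
  assumes "zh = z - p" "z' = z - q"
  shows "2 * (q \<bullet> (zh - w)) = (norm (z - w))\<^sup>2 - (norm (z' - w))\<^sup>2 + (norm (q - p))\<^sup>2 - (norm (zh - z))\<^sup>2"
  unfolding assms by (simp add: power2_norm_eq_inner algebra_simps inner_commute)

lemma norm_add_square:
  fixes x y :: "'a::real_inner"
  shows "(norm (x + y))\<^sup>2 = (norm x)\<^sup>2 + 2 * (x \<bullet> y) + (norm y)\<^sup>2"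
  by (simp add: power2_norm_eq_inner inner_add_left inner_add_right inner_commute)

lemma norm_diff_le_Young:
  fixes x y :: "'a::real_inner"
  assumes "\<beta> > 0"
  shows "(norm (x - y))\<^sup>2 \<le> (1 + \<beta>) * (norm x)\<^sup>2 + (1 + 1 / \<beta>) * (norm y)\<^sup>2"
proof -
  have "0 \<le> (1 / \<beta>) * (norm (\<beta> *\<^sub>R x + y))\<^sup>2" using assms by simp
  also have "\<dots> = \<beta> * (norm x)\<^sup>2 + 2 * (x \<bullet> y) + 1 / \<beta> * (norm y)\<^sup>2"
    using assms by (simp add: power2_norm_eq_inner algebra_simps inner_commute)
  finally show ?thesis
    by (simp add: power2_norm_eq_inner algebra_simps inner_commute)
qed

lemma neg_inner_le_Young:
  fixes x y :: "'a::real_inner"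
  assumes "c > 0"
  shows "- (x \<bullet> y) \<le> c / 2 * (norm x)\<^sup>2 + 1 / (2 * c) * (norm y)\<^sup>2"
proof -
  have "0 \<le> (1 / (2 * c)) * (norm (c *\<^sub>R x + y))\<^sup>2" using assms by simp
  also have "\<dots> = c / 2 * (norm x)\<^sup>2 + x \<bullet> y + 1 / (2 * c) * (norm y)\<^sup>2"
    using assms by (simp add: power2_norm_eq_inner algebra_simps inner_commute add_divide_distrib)
  finally show ?thesis by simp
qed

context skew_composite
begin

text \<open>Scaled by \<open>2 * \<eta> / \<alpha>\<close>. The step size condition makes the coefficient of
  \<open>norm (zh - z)\<close> nonpositive; the last line has mean zero.\<close>

lemma noisy_step:
  assumes \<alpha>: "0 < \<alpha>" "\<alpha> \<le> 1" and \<eta>: "0 < \<eta>" and \<beta>: "0 < \<beta>" and r: "r < 1"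
    and step: "\<alpha> * \<eta> * L + \<eta>\<^sup>2 * (1 + \<beta>) * K\<^sup>2 \<le> r"
    and md: "md = (1 - \<alpha>) *\<^sub>R ag + \<alpha> *\<^sub>R z" and ag': "ag' = (1 - \<alpha>) *\<^sub>R ag + \<alpha> *\<^sub>R zh"
    and zh: "zh = z - \<eta> *\<^sub>R ((g md + \<delta>) + (h z + \<epsilon>))"
    and z': "z' = z - \<eta> *\<^sub>R ((g md + \<delta>) + (h zh + \<epsilon>'))"
  shows "(norm (z' - w))\<^sup>2 + 2 * \<eta> / \<alpha> * gap ag' \<le>
      (norm (z - w))\<^sup>2 + 2 * \<eta> / \<alpha> * (1 - \<alpha>) * gap ag
      + \<eta>\<^sup>2 * (1 / (1 - r) * (norm \<delta>)\<^sup>2 + (1 + 1 / \<beta>) * (norm \<epsilon>)\<^sup>2 + (norm \<epsilon>')\<^sup>2)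
      + 2 * (\<eta>\<^sup>2 * (\<epsilon>' \<bullet> (h zh - h z - \<epsilon>)) - \<eta> * (\<delta> \<bullet> (z - w)) - \<eta> * (\<epsilon>' \<bullet> (zh - w)))"
proof -
  let ?p = "\<eta> *\<^sub>R ((g md + \<delta>) + (h z + \<epsilon>))" and ?q = "\<eta> *\<^sub>R ((g md + \<delta>) + (h zh + \<epsilon>'))"
  define N where "N = (norm (zh - z))\<^sup>2"
  have N: "0 \<le> N" by (simp add: N_def)
  have e: "2 * (?q \<bullet> (zh - w)) = (norm (z - w))\<^sup>2 - (norm (z' - w))\<^sup>2 + (norm (?q - ?p))\<^sup>2 - N"
    unfolding N_def by (rule extragradient_identity[OF zh z'])
  have "?q - ?p = \<eta> *\<^sub>R (\<epsilon>' + (h zh - h z - \<epsilon>))" by (simp add: scaleR_right_diff_distrib scaleR_right_distrib)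
  then have "(norm (?q - ?p))\<^sup>2 = \<eta>\<^sup>2 * (norm (\<epsilon>' + (h zh - h z - \<epsilon>)))\<^sup>2"
    by (simp add: power_mult_distrib)
  also have "(norm (\<epsilon>' + (h zh - h z - \<epsilon>)))\<^sup>2 =
      (norm \<epsilon>')\<^sup>2 + 2 * (\<epsilon>' \<bullet> (h zh - h z - \<epsilon>)) + (norm (h zh - h z - \<epsilon>))\<^sup>2"
    by (rule norm_add_square)
  also have "(norm (h zh - h z - \<epsilon>))\<^sup>2 \<le> (1 + \<beta>) * (K\<^sup>2 * N) + (1 + 1 / \<beta>) * (norm \<epsilon>)\<^sup>2"
  proof -
    have "(norm (h zh - h z))\<^sup>2 \<le> K\<^sup>2 * N"
      using power_mono[OF h_Lipschitz[of zh z], of 2] by (simp add: N_def power_mult_distrib)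
    then show ?thesis
      using norm_diff_le_Young[OF \<beta>, of "h zh - h z" \<epsilon>] \<beta>
      by (smt (verit) mult_left_mono)
  qed
  finally have qp: "(norm (?q - ?p))\<^sup>2 \<le> \<eta>\<^sup>2 * ((norm \<epsilon>')\<^sup>2 + 2 * (\<epsilon>' \<bullet> (h zh - h z - \<epsilon>))
      + ((1 + \<beta>) * (K\<^sup>2 * N) + (1 + 1 / \<beta>) * (norm \<epsilon>)\<^sup>2))"
    by (simp add: mult_left_mono)
  \<comment> \<open>Young's inequality with constant \<open>\<eta> / (1 - r)\<close>, chosen so that
    after multiplication by \<open>2 * \<eta>\<close> the coefficient of \<open>N\<close> is exactly
    \<open>1 - r\<close>.\<close>
  have \<delta>: "- (2 * \<eta> * (\<delta> \<bullet> (zh - z))) \<le> \<eta>\<^sup>2 * (1 / (1 - r) * (norm \<delta>)\<^sup>2) + (1 - r) * N"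
  proof -
    have "2 * \<eta> * - (\<delta> \<bullet> (zh - z)) \<le> 2 * \<eta> * (\<eta> / (1 - r) / 2 * (norm \<delta>)\<^sup>2 + 1 / (2 * (\<eta> / (1 - r))) * N)"
      using neg_inner_le_Young[of "\<eta> / (1 - r)" \<delta> "zh - z"] \<eta> r unfolding N_def
      by (intro mult_left_mono) auto
    also have "\<dots> = \<eta>\<^sup>2 * (1 / (1 - r) * (norm \<delta>)\<^sup>2) + (1 - r) * N"
      using \<eta> r by (simp add: field_simps power2_eq_square)
    finally show ?thesis by simp
  qed
  have "2 * \<eta> / \<alpha> * gap ag' \<le> 2 * \<eta> / \<alpha> *
      ((1 - \<alpha>) * gap ag + \<alpha> * ((g md + h zh) \<bullet> (zh - w)) + L * \<alpha>\<^sup>2 / 2 * N)"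
    using gap_momentum[OF _ _ md ag'] \<alpha> \<eta> unfolding N_def by (intro mult_left_mono) auto
  also have "\<dots> = 2 * \<eta> / \<alpha> * (1 - \<alpha>) * gap ag + 2 * \<eta> * ((g md + h zh) \<bullet> (zh - w)) + \<alpha> * \<eta> * L * N"
    using \<alpha> by (simp add: field_simps power2_eq_square)
  also have "2 * \<eta> * ((g md + h zh) \<bullet> (zh - w)) = 2 * (?q \<bullet> (zh - w)) - 2 * \<eta> * (\<delta> \<bullet> (z - w))
      - 2 * \<eta> * (\<delta> \<bullet> (zh - z)) - 2 * \<eta> * (\<epsilon>' \<bullet> (zh - w))"
    by (simp add: algebra_simps)
  finally have 1: "2 * \<eta> / \<alpha> * gap ag' \<le> 2 * \<eta> / \<alpha> * (1 - \<alpha>) * gap ag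
      + (2 * (?q \<bullet> (zh - w)) - 2 * \<eta> * (\<delta> \<bullet> (z - w))
      - 2 * \<eta> * (\<delta> \<bullet> (zh - z)) - 2 * \<eta> * (\<epsilon>' \<bullet> (zh - w))) + \<alpha> * \<eta> * L * N" .
  \<comment> \<open>Together with the share \<open>(1 - r) * N\<close> of \<open>\<delta>\<close>
    this uses up the \<open>- N\<close> of the extragradient identity, so no term in
    \<open>N\<close> survives.\<close>
  have "\<alpha> * \<eta> * L * N + \<eta>\<^sup>2 * ((1 + \<beta>) * (K\<^sup>2 * N)) \<le> r * N"
    using mult_right_mono[OF step N] by (simp only: distrib_right mult.assoc)
  then show ?thesis
    using 1 e qp \<delta> unfolding distrib_left right_diff_distrib left_diff_distrib by linarith
qed

end

section \<open>The step in expectation\<close>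

text \<open>At a frozen query point the noise has mean zero and second moment at most
  \<open>v\<close>; independence of \<open>Y\<close> from \<open>A\<close> transfers this to an
  \<open>A\<close>-measurable query point. With \<open>A\<close> left free the lemma serves all
  three oracle calls of a step.\<close>

lemma (in prob_space)
  fixes orc :: "'b::euclidean_space \<Rightarrow> 's \<Rightarrow> 'c::euclidean_space"
  assumes orc: "unbiased_oracle D orc G" and G: "G \<in> borel_measurable borel"
    and var: "\<And>x. mean_le D (\<lambda>s. (norm (orc x s - G x))\<^sup>2) v"
    and A: "subalgebra M A" and X: "X \<in> borel_measurable A"
    and Y: "Y \<in> measurable M D" "distr M D Y = D"
    and indep: "indep_set (sets A) (sets (vimage_algebra (space M) Y D))"
  shows oracle_noise_variance: "mean_le M (\<lambda>\<omega>. (norm (orc (X \<omega>) (Y \<omega>) - G (X \<omega>)))\<^sup>2) v"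
    and oracle_noise_square_integrable: "square_integrable M (\<lambda>\<omega>. orc (X \<omega>) (Y \<omega>) - G (X \<omega>))"
    and oracle_noise_orthogonal: "\<And>\<Psi>. \<Psi> \<in> borel_measurable A \<Longrightarrow> square_integrable M \<Psi> \<Longrightarrow>
      (\<integral>\<omega>. (orc (X \<omega>) (Y \<omega>) - G (X \<omega>)) \<bullet> \<Psi> \<omega> \<partial>M) = 0"
proof -
  have D: "prob_space D"
    using prob_space_distr[OF Y(1)] Y(2) by simp
  then interpret D: prob_space D .
  note XM = measurable_from_subalg[OF A X]
  have orc_meas: "(\<lambda>p. orc (fst p) (snd p)) \<in> borel_measurable (borel \<Otimes>\<^sub>M D)"
    using orc by (simp add: unbiased_oracle_def case_prod_unfold)
  have noise_meas: "(\<lambda>(x, s). orc x s - G x) \<in> borel_measurable (borel \<Otimes>\<^sub>M D)"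
    using orc_meas G by (simp add: case_prod_unfold)
  have law: "distr M (N \<Otimes>\<^sub>M D) (\<lambda>\<omega>. (Z \<omega>, Y \<omega>)) = distr M N Z \<Otimes>\<^sub>M D" if "Z \<in> measurable A N" for N and Z :: "'a \<Rightarrow> 'd"
    using distr_pair_indep_subalgebra[OF A that Y(1) indep] Y(2) by simp
  show var': "mean_le M (\<lambda>\<omega>. (norm (orc (X \<omega>) (Y \<omega>) - G (X \<omega>)))\<^sup>2) v"
    by (rule noise_second_moment[OF D XM Y(1) law[OF X] noise_meas var])
  have "(\<lambda>\<omega>. orc (X \<omega>) (Y \<omega>) - G (X \<omega>)) \<in> borel_measurable M"
    using measurable_compose[OF measurable_Pair[OF XM Y(1)] noise_meas] by simp
  with var' show sq: "square_integrable M (\<lambda>\<omega>. orc (X \<omega>) (Y \<omega>) - G (X \<omega>))"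
    by (simp add: square_integrable_def mean_le_def)
  fix \<Psi> :: "'a \<Rightarrow> 'c" assume \<Psi>: "\<Psi> \<in> borel_measurable A" and \<Psi>_sq: "square_integrable M \<Psi>"
  let ?N = "borel \<Otimes>\<^sub>M borel :: ('b \<times> 'c) measure"
  have Z: "(\<lambda>\<omega>. (X \<omega>, \<Psi> \<omega>)) \<in> measurable A ?N"
    by (rule measurable_Pair[OF X \<Psi>])
  have "(\<integral>\<omega>. (\<lambda>x s. orc (fst x) s - G (fst x)) (X \<omega>, \<Psi> \<omega>) (Y \<omega>) \<bullet> snd (X \<omega>, \<Psi> \<omega>) \<partial>M) = 0"
  proof (rule noise_orthogonal[OF D measurable_from_subalg[OF A Z] Y(1) law[OF Z]])
    have "(\<lambda>p. (fst (fst p), snd p)) \<in> measurable (?N \<Otimes>\<^sub>M D) (borel \<Otimes>\<^sub>M D)" by simp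
    from measurable_compose[OF this noise_meas]
    show "(\<lambda>(x, s). orc (fst x) s - G (fst x)) \<in> borel_measurable (?N \<Otimes>\<^sub>M D)"
      by (simp add: case_prod_unfold)
  qed (use orc integrable_inner_square[OF sq \<Psi>_sq] in \<open>simp_all add: unbiased_oracle_def D.prob_space\<close>)
  then show "(\<integral>\<omega>. (orc (X \<omega>) (Y \<omega>) - G (X \<omega>)) \<bullet> \<Psi> \<omega> \<partial>M) = 0" by simp
qed

text \<open>\<open>A s\<close> is the information after \<open>s\<close> steps, \<open>A' s\<close>
  also contains the first two samples of step \<open>Suc s\<close>. The index of \<open>zh\<close>
  and \<open>md\<close> is shifted: \<open>zh s\<close> is the half iterate of step
  \<open>Suc s\<close>, and \<open>md s\<close> is its query point. \<open>ag s\<close> has true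
  index \<open>s - 1/2\<close>, whence \<open>ag 0 = z 0\<close>.\<close>

locale ag_eg_process = skew_composite f g h \<mu> L K w + prob_space M
  for f :: "'a::euclidean_space \<Rightarrow> real" and g h \<mu> L K w and M :: "'w measure" +
  fixes D\<xi> :: "'s measure" and D\<zeta> :: "'z measure" and og oh and vg vh r \<beta> :: real and T :: nat
    and A A' :: "nat \<Rightarrow> 'w measure" and \<xi> \<zeta>h \<zeta>
    and \<alpha> \<eta> :: "nat \<Rightarrow> real" and z zh md ag :: "nat \<Rightarrow> 'w \<Rightarrow> 'a"
  assumes og: "unbiased_oracle D\<xi> og g" "\<And>x. mean_le D\<xi> (\<lambda>s. (norm (og x s - g x))\<^sup>2) vg"
    and oh: "unbiased_oracle D\<zeta> oh h" "\<And>x. mean_le D\<zeta> (\<lambda>s. (norm (oh x s - h x))\<^sup>2) vh"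
    and sub: "\<And>s. s \<le> T \<Longrightarrow> subalgebra M (A s)" "\<And>s. s < T \<Longrightarrow> subalgebra M (A' s)"
      "\<And>s. s < T \<Longrightarrow> subalgebra (A' s) (A s)" "\<And>s. s < T \<Longrightarrow> subalgebra (A (Suc s)) (A' s)"
    and \<xi>: "\<And>s. s < T \<Longrightarrow> \<xi> (Suc s) \<in> measurable (A' s) D\<xi>"
      "\<And>s. s < T \<Longrightarrow> distr M D\<xi> (\<xi> (Suc s)) = D\<xi>"
      "\<And>s. s < T \<Longrightarrow> indep_set (sets (A s)) (sets (vimage_algebra (space M) (\<xi> (Suc s)) D\<xi>))"
    and \<zeta>h: "\<And>s. s < T \<Longrightarrow> \<zeta>h (Suc s) \<in> measurable (A' s) D\<zeta>"
      "\<And>s. s < T \<Longrightarrow> distr M D\<zeta> (\<zeta>h (Suc s)) = D\<zeta>"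
      "\<And>s. s < T \<Longrightarrow> indep_set (sets (A s)) (sets (vimage_algebra (space M) (\<zeta>h (Suc s)) D\<zeta>))"
    and \<zeta>: "\<And>s. s < T \<Longrightarrow> \<zeta> (Suc s) \<in> measurable (A (Suc s)) D\<zeta>"
      "\<And>s. s < T \<Longrightarrow> distr M D\<zeta> (\<zeta> (Suc s)) = D\<zeta>"
      "\<And>s. s < T \<Longrightarrow> indep_set (sets (A' s)) (sets (vimage_algebra (space M) (\<zeta> (Suc s)) D\<zeta>))"
    and z_0: "z 0 \<in> borel_measurable (A 0)" "square_integrable M (z 0)"
    and ag_0: "ag 0 = z 0"
    and md: "\<And>s \<omega>. md s \<omega> = (1 - \<alpha> (Suc s)) *\<^sub>R ag s \<omega> + \<alpha> (Suc s) *\<^sub>R z s \<omega>"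
    and zh: "\<And>s \<omega>. zh s \<omega> = z s \<omega> - \<eta> (Suc s) *\<^sub>R (og (md s \<omega>) (\<xi> (Suc s) \<omega>) + oh (z s \<omega>) (\<zeta>h (Suc s) \<omega>))"
    and z_Suc: "\<And>s \<omega>. z (Suc s) \<omega> = z s \<omega> - \<eta> (Suc s) *\<^sub>R (og (md s \<omega>) (\<xi> (Suc s) \<omega>) + oh (zh s \<omega>) (\<zeta> (Suc s) \<omega>))"
    and ag_Suc: "\<And>s \<omega>. ag (Suc s) \<omega> = (1 - \<alpha> (Suc s)) *\<^sub>R ag s \<omega> + \<alpha> (Suc s) *\<^sub>R zh s \<omega>"
    and r: "r < 1" and \<beta>: "0 < \<beta>"
    and \<alpha>: "\<And>s. s < T \<Longrightarrow> 0 < \<alpha> (Suc s) \<and> \<alpha> (Suc s) \<le> 1"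
    and \<eta>: "\<And>s. s < T \<Longrightarrow> 0 < \<eta> (Suc s)"
    and step_size: "\<And>s. s < T \<Longrightarrow> \<alpha> (Suc s) * \<eta> (Suc s) * L + (\<eta> (Suc s))\<^sup>2 * (1 + \<beta>) * K\<^sup>2 \<le> r"
begin

lemma g_measurable: "g \<in> borel_measurable borel"
  using g_Lipschitz by (rule borel_measurable_Lipschitz)

lemma h_measurable: "h \<in> borel_measurable borel"
  using h_Lipschitz by (rule borel_measurable_Lipschitz)

lemma oracle_measurable:
  assumes "unbiased_oracle D orc G" "X \<in> borel_measurable N" "Y \<in> measurable N D"
  shows "(\<lambda>\<omega>. orc (X \<omega>) (Y \<omega>)) \<in> borel_measurable N"
proof -
  have "(\<lambda>p. orc (fst p) (snd p)) \<in> borel_measurable (borel \<Otimes>\<^sub>M D)"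
    using assms(1) by (simp add: unbiased_oracle_def case_prod_unfold)
  from measurable_compose[OF measurable_Pair[OF assms(2,3)] this] show ?thesis by simp
qed

lemma step_measurable:
  assumes s: "s < T" and z: "z s \<in> borel_measurable (A s)" and ag: "ag s \<in> borel_measurable (A s)"
  shows "md s \<in> borel_measurable (A s)"
    and "(\<lambda>\<omega>. oh (z s \<omega>) (\<zeta>h (Suc s) \<omega>)) \<in> borel_measurable (A' s)"
    and "zh s \<in> borel_measurable (A' s)"
    and "z (Suc s) \<in> borel_measurable (A (Suc s))"
    and "ag (Suc s) \<in> borel_measurable (A (Suc s))"
proof -
  show md': "md s \<in> borel_measurable (A s)"
    unfolding md using z ag by simp
  note up = measurable_from_subalg[OF sub(3)[OF s]] and up' = measurable_from_subalg[OF sub(4)[OF s]]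
  show k: "(\<lambda>\<omega>. oh (z s \<omega>) (\<zeta>h (Suc s) \<omega>)) \<in> borel_measurable (A' s)"
    by (rule oracle_measurable[OF oh(1) up[OF z] \<zeta>h(1)[OF s]])
  have og': "(\<lambda>\<omega>. og (md s \<omega>) (\<xi> (Suc s) \<omega>)) \<in> borel_measurable (A' s)"
    by (rule oracle_measurable[OF og(1) up[OF md'] \<xi>(1)[OF s]])
  show zh': "zh s \<in> borel_measurable (A' s)"
    unfolding zh using up[OF z] og' k by simp
  have k': "(\<lambda>\<omega>. oh (zh s \<omega>) (\<zeta> (Suc s) \<omega>)) \<in> borel_measurable (A (Suc s))"
    by (rule oracle_measurable[OF oh(1) up'[OF zh'] \<zeta>(1)[OF s]])
  show "z (Suc s) \<in> borel_measurable (A (Suc s))"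
    unfolding z_Suc using up'[OF up[OF z]] up'[OF og'] k' by simp
  show "ag (Suc s) \<in> borel_measurable (A (Suc s))"
    unfolding ag_Suc using up'[OF up[OF ag]] up'[OF zh'] by simp
qed

lemma iterates_measurable: "s \<le> T \<Longrightarrow> z s \<in> borel_measurable (A s) \<and> ag s \<in> borel_measurable (A s)"
proof (induction s)
  case 0
  show ?case using z_0 ag_0 by simp
next
  case (Suc s)
  then show ?case using step_measurable(4,5)[of s] by simp
qed

definition \<delta> where "\<delta> s \<omega> = og (md s \<omega>) (\<xi> (Suc s) \<omega>) - g (md s \<omega>)"
definition \<epsilon> where "\<epsilon> s \<omega> = oh (z s \<omega>) (\<zeta>h (Suc s) \<omega>) - h (z s \<omega>)"
definition \<epsilon>' where "\<epsilon>' s \<omega> = oh (zh s \<omega>) (\<zeta> (Suc s) \<omega>) - h (zh s \<omega>)"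

lemmas meas = iterates_measurable[OF less_imp_le, THEN conjunct1] iterates_measurable[OF less_imp_le, THEN conjunct2]
lemmas meas' = step_measurable(1-3)[OF _ meas]
lemmas \<xi>' = measurable_from_subalg[OF sub(2) \<xi>(1)] \<xi>(2,3)
lemmas \<zeta>h' = measurable_from_subalg[OF sub(2) \<zeta>h(1)] \<zeta>h(2,3)
lemmas \<zeta>' = measurable_from_subalg[OF sub(1)[OF Suc_leI] \<zeta>(1)] \<zeta>(2,3)
text \<open>The premises of the oracle noise lemma in its order. The first two calls are tested
  against \<open>A s\<close>; the third is tested against \<open>A' s\<close>, because its query
  point \<open>zh s\<close> depends on the first two samples.\<close>

lemmas \<delta>_noise = og(1) g_measurable og(2) sub(1)[OF less_imp_le] meas'(1) \<xi>'
lemmas \<epsilon>_noise = oh(1) h_measurable oh(2) sub(1)[OF less_imp_le] meas(1) \<zeta>h'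
lemmas \<epsilon>'_noise = oh(1) h_measurable oh(2) sub(2) meas'(3) \<zeta>'

lemma noise_square_integrable:
  assumes "s < T"
  shows "square_integrable M (\<delta> s)" "square_integrable M (\<epsilon> s)" "square_integrable M (\<epsilon>' s)"
  unfolding \<delta>_def[abs_def] \<epsilon>_def[abs_def] \<epsilon>'_def[abs_def]
  by ((rule oracle_noise_square_integrable[OF \<delta>_noise] oracle_noise_square_integrable[OF \<epsilon>_noise]
    oracle_noise_square_integrable[OF \<epsilon>'_noise]; rule assms)+)

lemma noise_variance:
  assumes "s < T"
  shows "mean_le M (\<lambda>\<omega>. (norm (\<delta> s \<omega>))\<^sup>2) vg" "mean_le M (\<lambda>\<omega>. (norm (\<epsilon> s \<omega>))\<^sup>2) vh"
    "mean_le M (\<lambda>\<omega>. (norm (\<epsilon>' s \<omega>))\<^sup>2) vh"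
  unfolding \<delta>_def \<epsilon>_def \<epsilon>'_def
  by ((rule oracle_noise_variance[OF \<delta>_noise] oracle_noise_variance[OF \<epsilon>_noise]
    oracle_noise_variance[OF \<epsilon>'_noise]; rule assms)+)

lemma zh_noise: "zh s \<omega> = z s \<omega> - \<eta> (Suc s) *\<^sub>R ((g (md s \<omega>) + \<delta> s \<omega>) + (h (z s \<omega>) + \<epsilon> s \<omega>))"
  by (simp add: zh \<delta>_def \<epsilon>_def)

lemma z_Suc_noise: "z (Suc s) \<omega> = z s \<omega> - \<eta> (Suc s) *\<^sub>R ((g (md s \<omega>) + \<delta> s \<omega>) + (h (zh s \<omega>) + \<epsilon>' s \<omega>))"
  by (simp add: z_Suc \<delta>_def \<epsilon>'_def)

text \<open>The variance bound is uniform in the query point, so the noise is square integrable in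
  any case. With oracle answers written as exact value plus noise, only linear combinations and
  Lipschitz maps remain.\<close>

lemma step_square_integrable:
  assumes s: "s < T" and z: "square_integrable M (z s)" and ag: "square_integrable M (ag s)"
  shows "square_integrable M (zh s)" "square_integrable M (z (Suc s))" "square_integrable M (ag (Suc s))"
proof -
  have md': "square_integrable M (\<lambda>\<omega>. md s \<omega>)"
    unfolding md by (intro square_integrable_add square_integrable_scaleR z ag)
  note gmd = square_integrable_Lipschitz[OF md' g_measurable g_Lipschitz]
  have hz: "square_integrable M X \<Longrightarrow> square_integrable M (\<lambda>\<omega>. h (X \<omega>))" for X
    by (rule square_integrable_Lipschitz[OF _ h_measurable h_Lipschitz])
  note noise = noise_square_integrable[OF s]
  have "square_integrable M (\<lambda>\<omega>. zh s \<omega>)"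
    unfolding zh_noise
    by (intro square_integrable_diff square_integrable_scaleR square_integrable_add z gmd hz noise)
  then show zh': "square_integrable M (zh s)" by simp
  have "square_integrable M (\<lambda>\<omega>. z (Suc s) \<omega>)"
    unfolding z_Suc_noise
    by (intro square_integrable_diff square_integrable_scaleR square_integrable_add z gmd hz zh' noise)
  then show "square_integrable M (z (Suc s))" by simp
  have "square_integrable M (\<lambda>\<omega>. ag (Suc s) \<omega>)"
    unfolding ag_Suc by (intro square_integrable_add square_integrable_scaleR ag zh')
  then show "square_integrable M (ag (Suc s))" by simp
qed

lemma iterates_square_integrable: "s \<le> T \<Longrightarrow> square_integrable M (z s) \<and> square_integrable M (ag s)"
proof (induction s)
  case 0
  show ?case using z_0 ag_0 by simp
next
  case (Suc s)
  then show ?case using step_square_integrable(2,3)[of s] by simp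
qed

lemma gap_measurable: "gap \<in> borel_measurable borel"
  unfolding gap_def[abs_def] using f_measurable by simp

lemma gap_integrable:
  assumes X: "square_integrable M X"
  shows "integrable M (\<lambda>\<omega>. gap (X \<omega>))"
proof (rule Bochner_Integration.integrable_bound)
  show "integrable M (\<lambda>\<omega>. L / 2 * (norm (X \<omega> - w))\<^sup>2)"
    using square_integrable_diff[OF X square_integrable_const[of w]] by (simp add: square_integrable_def)
  show "(\<lambda>\<omega>. gap (X \<omega>)) \<in> borel_measurable M"
    using X by (auto simp: square_integrable_def intro: measurable_compose[OF _ gap_measurable])
  have "norm (gap x) \<le> norm (L / 2 * (norm (x - w))\<^sup>2)" for x
    using gap_le[of x] gap_nonneg[of x] by simp
  then show "AE \<omega> in M. norm (gap (X \<omega>)) \<le> norm (L / 2 * (norm (X \<omega> - w))\<^sup>2)"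
    by blast
qed

lemma expected_step:
  assumes s: "s < T"
  shows "(\<integral>\<omega>. (norm (z (Suc s) \<omega> - w))\<^sup>2 \<partial>M) + 2 * \<eta> (Suc s) / \<alpha> (Suc s) * (\<integral>\<omega>. gap (ag (Suc s) \<omega>) \<partial>M) \<le>
    (\<integral>\<omega>. (norm (z s \<omega> - w))\<^sup>2 \<partial>M) + 2 * \<eta> (Suc s) / \<alpha> (Suc s) * (1 - \<alpha> (Suc s)) * (\<integral>\<omega>. gap (ag s \<omega>) \<partial>M)
    + (\<eta> (Suc s))\<^sup>2 * (1 / (1 - r) * vg + (2 + 1 / \<beta>) * vh)"
proof -
  let ?\<eta> = "\<eta> (Suc s)" and ?\<alpha> = "\<alpha> (Suc s)"
  have sq: "square_integrable M (z s)" "square_integrable M (ag s)"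
    using iterates_square_integrable[of s] s by auto
  note sq' = step_square_integrable[OF s sq]
  note noise = noise_square_integrable[OF s]
  have dist_sq: "square_integrable M (\<lambda>\<omega>. X \<omega> - w)" if "square_integrable M X" for X
    by (rule square_integrable_diff[OF that square_integrable_const])
  let ?e = "\<lambda>\<omega>. h (zh s \<omega>) - h (z s \<omega>) - \<epsilon> s \<omega>"
  have e_sq: "square_integrable M ?e"
    by (intro square_integrable_diff square_integrable_Lipschitz[OF _ h_measurable h_Lipschitz] sq sq' noise)
  note mz = measurable_from_subalg[OF sub(3)[OF s] meas(1)[OF s]]
  have "(\<lambda>\<omega>. \<epsilon> s \<omega>) \<in> borel_measurable (A' s)"
    unfolding \<epsilon>_def using meas'(2)[OF s s s] measurable_compose[OF mz h_measurable] by simp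
  then have e_meas: "?e \<in> borel_measurable (A' s)"
    using measurable_compose[OF mz h_measurable] measurable_compose[OF meas'(3)[OF s s s] h_measurable] by simp
  have orth1: "(\<integral>\<omega>. \<delta> s \<omega> \<bullet> (z s \<omega> - w) \<partial>M) = 0"
    unfolding \<delta>_def using s sq(1) meas(1)[OF s]
    by (intro oracle_noise_orthogonal[OF \<delta>_noise] dist_sq) simp_all
  have orth2: "(\<integral>\<omega>. \<epsilon>' s \<omega> \<bullet> (zh s \<omega> - w) \<partial>M) = 0"
    unfolding \<epsilon>'_def using s sq'(1) meas'(3)[OF s s s]
    by (intro oracle_noise_orthogonal[OF \<epsilon>'_noise] dist_sq) simp_all
  \<comment> \<open>The noise \<open>\<epsilon>\<close> of the half step is already known in
    \<open>A' s\<close>, so \<open>?e\<close> is an admissible test vector for the fresh noise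
    \<open>\<epsilon>'\<close>.\<close>
  have orth3: "(\<integral>\<omega>. \<epsilon>' s \<omega> \<bullet> ?e \<omega> \<partial>M) = 0"
    using s e_sq e_meas unfolding \<epsilon>'_def
    by (intro oracle_noise_orthogonal[OF \<epsilon>'_noise]) simp_all
  have int2: "integrable M (\<lambda>\<omega>. (norm (X \<omega>))\<^sup>2)" if "square_integrable M X" for X :: "'w \<Rightarrow> 'a"
    using that by (simp add: square_integrable_def)
  note [simp] = int2[OF dist_sq[OF sq(1)]] int2[OF dist_sq[OF sq'(2)]] noise[THEN int2]
    gap_integrable[OF sq(2)] gap_integrable[OF sq'(3)]
    integrable_inner_square[OF noise(3) e_sq] integrable_inner_square[OF noise(1) dist_sq[OF sq(1)]]
    integrable_inner_square[OF noise(3) dist_sq[OF sq'(1)]]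
  have var: "(\<integral>\<omega>. (norm (\<delta> s \<omega>))\<^sup>2 \<partial>M) \<le> vg" "(\<integral>\<omega>. (norm (\<epsilon> s \<omega>))\<^sup>2 \<partial>M) \<le> vh" "(\<integral>\<omega>. (norm (\<epsilon>' s \<omega>))\<^sup>2 \<partial>M) \<le> vh"
    using noise_variance[OF s] by (simp_all add: mean_le_def)
  let ?rhs = "\<lambda>\<omega>. (norm (z s \<omega> - w))\<^sup>2 + 2 * ?\<eta> / ?\<alpha> * (1 - ?\<alpha>) * gap (ag s \<omega>)
      + ?\<eta>\<^sup>2 * (1 / (1 - r) * (norm (\<delta> s \<omega>))\<^sup>2 + (1 + 1 / \<beta>) * (norm (\<epsilon> s \<omega>))\<^sup>2 + (norm (\<epsilon>' s \<omega>))\<^sup>2)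
      + 2 * (?\<eta>\<^sup>2 * (\<epsilon>' s \<omega> \<bullet> ?e \<omega>) - ?\<eta> * (\<delta> s \<omega> \<bullet> (z s \<omega> - w)) - ?\<eta> * (\<epsilon>' s \<omega> \<bullet> (zh s \<omega> - w)))"
  have "(\<integral>\<omega>. (norm (z (Suc s) \<omega> - w))\<^sup>2 \<partial>M) + 2 * ?\<eta> / ?\<alpha> * (\<integral>\<omega>. gap (ag (Suc s) \<omega>) \<partial>M) =
      (\<integral>\<omega>. (norm (z (Suc s) \<omega> - w))\<^sup>2 + 2 * ?\<eta> / ?\<alpha> * gap (ag (Suc s) \<omega>) \<partial>M)"
    by simp
  also have "\<dots> \<le> (\<integral>\<omega>. ?rhs \<omega> \<partial>M)"
  proof (rule integral_mono)
    fix \<omega>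
    show "(norm (z (Suc s) \<omega> - w))\<^sup>2 + 2 * ?\<eta> / ?\<alpha> * gap (ag (Suc s) \<omega>) \<le> ?rhs \<omega>"
      using \<alpha>[OF s] \<eta>[OF s]
      by (intro noisy_step[OF _ _ _ \<beta> r step_size[OF s] md ag_Suc zh_noise z_Suc_noise]) auto
  qed simp_all
  also have "\<dots> = (\<integral>\<omega>. (norm (z s \<omega> - w))\<^sup>2 \<partial>M) + 2 * ?\<eta> / ?\<alpha> * (1 - ?\<alpha>) * (\<integral>\<omega>. gap (ag s \<omega>) \<partial>M)
      + ?\<eta>\<^sup>2 * (1 / (1 - r) * (\<integral>\<omega>. (norm (\<delta> s \<omega>))\<^sup>2 \<partial>M) + (1 + 1 / \<beta>) * (\<integral>\<omega>. (norm (\<epsilon> s \<omega>))\<^sup>2 \<partial>M)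
        + (\<integral>\<omega>. (norm (\<epsilon>' s \<omega>))\<^sup>2 \<partial>M))"
    by (simp add: orth1 orth2 orth3)
  also have "\<dots> \<le> (\<integral>\<omega>. (norm (z s \<omega> - w))\<^sup>2 \<partial>M) + 2 * ?\<eta> / ?\<alpha> * (1 - ?\<alpha>) * (\<integral>\<omega>. gap (ag s \<omega>) \<partial>M)
      + ?\<eta>\<^sup>2 * (1 / (1 - r) * vg + (1 + 1 / \<beta>) * vh + vh)"
    using var r \<beta> by (intro add_mono mult_left_mono order_refl) auto
  finally show ?thesis
    by (simp add: algebra_simps)
qed

end

section \<open>Rate of convergence\<close>

text \<open>With \<open>d = m + b * t\<close> the two terms are at most \<open>r * (m / d)\<close>
  and \<open>r * (b * t / d)^2\<close>. The fractions \<open>m / d\<close> and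
  \<open>b * t / d\<close> lie in [0, 1] and add up to 1, and squaring the second only lowers it.
  This fixes the constants \<open>2 / r\<close> in \<open>m\<close> and
  \<open>sqrt ((1 + \<beta>) / r)\<close> in \<open>b\<close>.\<close>

lemma step_size_condition:
  fixes L K m b r \<beta> :: real
  assumes "0 < L" "0 < r" "0 < \<beta>" "0 \<le> K" and m: "2 / r * L \<le> m" and b: "b = sqrt ((1 + \<beta>) / r) * K"
    and t: "1 \<le> t" and \<eta>: "\<eta> = real t / (m + b * real t)"
  shows "2 / (real t + 1) * \<eta> * L + \<eta>\<^sup>2 * (1 + \<beta>) * K\<^sup>2 \<le> r"
proof -
  have "0 < 2 / r * L" using assms(1,2) by simp
  then have m_pos: "0 < m" using m by linarith
  have b_nonneg: "0 \<le> b" using assms by simp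
  define d where "d = m + b * real t"
  have d: "0 < d" using m_pos b_nonneg t unfolding d_def by (simp add: add_pos_nonneg)
  have b2: "(1 + \<beta>) * K\<^sup>2 = r * b\<^sup>2"
    using assms by (simp add: power_mult_distrib)
  have "2 / (real t + 1) * \<eta> * L = (2 * L) / d * (real t / (real t + 1))"
    by (simp add: \<eta> d_def ac_simps)
  also have "\<dots> \<le> (r * m) / d * 1"
  proof (rule mult_mono)
    have "2 * L \<le> r * m" using m assms(2) by (simp add: field_simps)
    then show "2 * L / d \<le> r * m / d" using d by (intro divide_right_mono) auto
  qed (use assms(2) d m_pos in auto)
  finally have 1: "2 / (real t + 1) * \<eta> * L \<le> r * (m / d)" by simp
  have q: "0 \<le> b * real t / d" "b * real t / d \<le> 1"
    using b_nonneg m_pos d by (auto simp: d_def)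
  have "\<eta>\<^sup>2 * (1 + \<beta>) * K\<^sup>2 = r * (b * real t / d)\<^sup>2"
    unfolding mult.assoc b2 by (simp add: \<eta> d_def power_mult_distrib power_divide)
  also have "\<dots> \<le> r * (b * real t / d)"
    unfolding power2_eq_square using assms(2) by (intro mult_left_mono mult_left_le q) auto
  finally have "\<eta>\<^sup>2 * (1 + \<beta>) * K\<^sup>2 \<le> r * (b * real t / d)" .
  with 1 have "2 / (real t + 1) * \<eta> * L + \<eta>\<^sup>2 * (1 + \<beta>) * K\<^sup>2 \<le> r * (m / d + b * real t / d)"
    by (simp add: distrib_left)
  also have "m / d + b * real t / d = 1"
    using d by (simp add: add_divide_distrib[symmetric] d_def)
  finally show ?thesis by simp
qed

text \<open>The exact sum is \<open>n * (n + 1) * (2 * n + 1) / 6\<close>; raising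
  \<open>2 * n + 1\<close> to \<open>2 * n + 2\<close> gives the expression under the root in the
  step size.\<close>

lemma sum_squares_le: "3 * (\<Sum>i<n. (real (Suc i))\<^sup>2) \<le> real n * (real n + 1)\<^sup>2"
proof (induction n)
  case (Suc n)
  have "3 * (\<Sum>i<Suc n. (real (Suc i))\<^sup>2) \<le> real n * (real n + 1)\<^sup>2 + 3 * (real n + 1)\<^sup>2"
    using Suc by (simp add: add.commute)
  also have "\<dots> \<le> real (Suc n) * (real (Suc n) + 1)\<^sup>2"
    by (simp add: power2_eq_square algebra_simps)
  finally show ?case .
qed simp

lemma (in ag_eg_process) output_distance:
  assumes m: "0 < m" and b: "0 \<le> b" and T: "1 \<le> T"
    and \<alpha>_eq: "\<And>t. \<alpha> t = 2 / (real t + 1)"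
    and \<eta>_eq: "\<And>t. \<eta> t = real t / (m + b * real t)"
    and v: "1 / (1 - r) * vg + (2 + 1 / \<beta>) * vh = 3 * \<sigma>\<^sup>2"
  shows "mean_le M (\<lambda>\<omega>. (norm (ag T \<omega> - w))\<^sup>2)
    (2 / \<mu> * ((m + b * real T) / (real T * (real T + 1)) *
      ((\<integral>\<omega>. (norm (z 0 \<omega> - w))\<^sup>2 \<partial>M) + \<sigma>\<^sup>2 * (real T * (real T + 1)\<^sup>2) / (m + b)\<^sup>2)))"
proof -
  define V where "V s = (\<integral>\<omega>. gap (ag s \<omega>) \<partial>M)" for s
  define D where "D s = (\<integral>\<omega>. (norm (z s \<omega> - w))\<^sup>2 \<partial>M)" for s
  have V: "0 \<le> V s" for s
    unfolding V_def by (simp add: gap_nonneg)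
  have den: "0 < m + b * real t" for t :: nat
    using m b by (simp add: add_pos_nonneg)
  have potential: "D s + \<eta> s * (real s + 1) * V s \<le> D 0 + 3 * \<sigma>\<^sup>2 * (\<Sum>i<s. (\<eta> (Suc i))\<^sup>2)" if "s \<le> T" for s
    using that
  proof (induction s)
    \<comment> \<open>Since \<open>\<eta> 0 = 0\<close>, the gap at the starting point has weight
      zero and the bound contains only \<open>D 0\<close>.\<close>
    case 0
    show ?case by (simp add: \<eta>_eq)
  next
    case (Suc s)
    \<comment> \<open>For \<open>t = Suc s\<close> the choice
      \<open>\<alpha> t = 2 / (t + 1)\<close> makes the weight of the new gap
      \<open>\<eta> t * (t + 1)\<close>, and that of the old one
      \<open>\<eta> t * (t - 1)\<close>.\<close>
    have "2 * \<eta> (Suc s) / \<alpha> (Suc s) = \<eta> (Suc s) * (real s + 2)"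
      by (simp add: \<alpha>_eq)
    moreover have "(real s + 2) * (1 - \<alpha> (Suc s)) = real s"
      by (simp add: \<alpha>_eq field_simps)
    ultimately have "D (Suc s) + \<eta> (Suc s) * (real s + 2) * V (Suc s) \<le>
        D s + \<eta> (Suc s) * real s * V s + (\<eta> (Suc s))\<^sup>2 * (3 * \<sigma>\<^sup>2)"
      using expected_step[of s] Suc.prems unfolding V_def D_def v by (simp add: mult.assoc)
    moreover have "\<eta> (Suc s) * real s * V s \<le> \<eta> s * (real s + 1) * V s"
    proof (rule mult_right_mono[OF _ V])
      have "real (Suc s) * real s / (m + b * real (Suc s)) \<le> real (Suc s) * real s / (m + b * real s)"
        using b by (intro divide_left_mono mult_pos_pos den) (auto simp: algebra_simps)
      then show "\<eta> (Suc s) * real s \<le> \<eta> s * (real s + 1)"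
        by (simp add: \<eta>_eq ac_simps)
    qed
    ultimately show ?case
      using Suc by (simp add: algebra_simps)
  qed
  \<comment> \<open>\<open>1 / (m + b)\<close> is \<open>\<eta> 1\<close>, so all step sizes are
    compared with the first; this is how \<open>\<eta> 1\<close> gets into the prefactor.\<close>
  have "\<eta> (Suc i) \<le> real (Suc i) / (m + b)" for i
    unfolding \<eta>_eq using m b den[of "Suc i"]
    by (intro divide_left_mono mult_pos_pos) (auto simp: algebra_simps intro: add_pos_nonneg)
  moreover have "0 \<le> \<eta> t" for t
    using den[of t] by (simp add: \<eta>_eq)
  ultimately have "(\<Sum>i<T. (\<eta> (Suc i))\<^sup>2) \<le> (\<Sum>i<T. (real (Suc i))\<^sup>2 / (m + b)\<^sup>2)"
    by (intro sum_mono) (metis power_divide power_mono)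
  also have "\<dots> = (\<Sum>i<T. (real (Suc i))\<^sup>2) / (m + b)\<^sup>2"
    by (simp add: sum_divide_distrib)
  also have "\<dots> \<le> (real T * (real T + 1)\<^sup>2 / 3) / (m + b)\<^sup>2"
    using sum_squares_le[of T] by (intro divide_right_mono) auto
  finally have "3 * \<sigma>\<^sup>2 * (\<Sum>i<T. (\<eta> (Suc i))\<^sup>2) \<le> 3 * \<sigma>\<^sup>2 * ((real T * (real T + 1)\<^sup>2 / 3) / (m + b)\<^sup>2)"
    by (rule mult_left_mono) simp
  moreover have "0 \<le> D T" by (simp add: D_def)
  ultimately have le: "\<eta> T * (real T + 1) * V T \<le> D 0 + \<sigma>\<^sup>2 * (real T * (real T + 1)\<^sup>2) / (m + b)\<^sup>2" (is "_ \<le> ?B")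
    using potential[of T] by simp
  have "V T = (m + b * real T) / (real T * (real T + 1)) * (\<eta> T * (real T + 1) * V T)"
    using den[of T] T by (simp add: \<eta>_eq)
  also have "\<dots> \<le> (m + b * real T) / (real T * (real T + 1)) * ?B"
    using den[of T] by (intro mult_left_mono le) simp
  finally have V_le: "V T \<le> (m + b * real T) / (real T * (real T + 1)) * ?B" .
  have ag_sq: "square_integrable M (ag T)"
    using iterates_square_integrable[of T] by simp
  have int: "integrable M (\<lambda>\<omega>. (norm (ag T \<omega> - w))\<^sup>2)"
    using square_integrable_diff[OF ag_sq square_integrable_const[of w]] by (simp add: square_integrable_def)
  have "(\<integral>\<omega>. (norm (ag T \<omega> - w))\<^sup>2 \<partial>M) \<le> (\<integral>\<omega>. 2 / \<mu> * gap (ag T \<omega>) \<partial>M)"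
  proof (rule integral_mono[OF int])
    show "integrable M (\<lambda>\<omega>. 2 / \<mu> * gap (ag T \<omega>))"
      using gap_integrable[OF ag_sq] by simp
    show "(norm (ag T \<omega> - w))\<^sup>2 \<le> 2 / \<mu> * gap (ag T \<omega>)" for \<omega>
      using gap_ge[of "ag T \<omega>"] \<mu>_pos by (simp add: field_simps)
  qed
  also have "\<dots> = 2 / \<mu> * V T" by (simp add: V_def)
  also have "\<dots> \<le> 2 / \<mu> * ((m + b * real T) / (real T * (real T + 1)) * ?B)"
    using V_le \<mu>_pos by (intro mult_left_mono) auto
  finally show ?thesis
    using int by (simp add: mean_le_def D_def)
qed

lemma prefactor_eq:
  fixes L K D C r \<beta> s :: real
  assumes "Q = s * sqrt (real T * (real T + 1)\<^sup>2)"
    and "m = max (2 / r * L) (Q / (C * D))" and "b = sqrt ((1 + \<beta>) / r) * K"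
  shows "prefactor L K D T C r \<beta> s = 1 + C * Q / ((m + b) * D)"
  unfolding assms by (simp add: prefactor_def eta_bar_def)

text \<open>The second entry of the maximum in the step size gives
  \<open>Q \<le> (m + b) * (C * D)\<close>, which turns the fraction into at most
  \<open>C^2\<close>.\<close>

lemma prefactor_bounds:
  assumes "0 < L" "0 \<le> K" "0 < D" "0 < C" "0 < r" "0 < \<beta>" "0 \<le> s"
  shows "prefactor L K D T C r \<beta> s \<in> {1..1 + C\<^sup>2}"
proof -
  define Q where "Q = s * sqrt (real T * (real T + 1)\<^sup>2)"
  define m where "m = max (2 / r * L) (Q / (C * D))"
  define b where "b = sqrt ((1 + \<beta>) / r) * K"
  have Q: "0 \<le> Q" using assms by (simp add: Q_def)
  have "0 < 2 / r * L" using assms by simp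
  then have m: "0 < m" by (simp add: m_def)
  have b: "0 \<le> b" using assms by (simp add: b_def)
  have "Q = Q / (C * D) * (C * D)" using assms by simp
  also have "\<dots> \<le> (m + b) * (C * D)"
    using b assms by (intro mult_right_mono) (auto simp: m_def)
  finally have "C * Q \<le> C * ((m + b) * (C * D))"
    using assms by (intro mult_left_mono) auto
  then have "C * Q / ((m + b) * D) \<le> C\<^sup>2"
    using m b assms by (simp add: pos_divide_le_eq power2_eq_square ac_simps)
  moreover have "0 \<le> C * Q / ((m + b) * D)"
    using m b Q assms by simp
  ultimately show ?thesis
    unfolding prefactor_eq[OF Q_def m_def b_def] by simp
qed

text \<open>The two noise contributions \<open>D\<^sup>2 * Q / (C * D)\<close> and \<open>m * Q\<^sup>2 / (m + b)\<^sup>2\<close> give the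
  constants \<open>1 / C\<close> and \<open>C\<close>; both use \<open>Q / (C * D) \<le> m\<close>.\<close>

lemma final_bound:
  assumes "0 < L" "0 \<le> K" "0 < D" "0 < C" "0 < r" "0 < \<beta>" "0 \<le> \<sigma>" "1 \<le> T" "0 < \<mu>"
    and Q: "Q = \<sigma> * sqrt (real T * (real T + 1)\<^sup>2)"
    and m: "m = max (2 / r * L) (Q / (C * D))" and b: "b = sqrt ((1 + \<beta>) / r) * K"
  shows "2 / \<mu> * ((m + b * real T) / (real T * (real T + 1)) *
      (D\<^sup>2 + \<sigma>\<^sup>2 * (real T * (real T + 1)\<^sup>2) / (m + b)\<^sup>2)) \<le>
    2 / (\<mu> * (real T + 1)) * (2 / r * L / real T + prefactor L K D T C r \<beta> \<sigma> * sqrt ((1 + \<beta>) / r) * K) * D\<^sup>2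
      + 2 * (1 / C + C) * \<sigma> / (\<mu> * sqrt (real T)) * D"
proof -
  have Q_nonneg: "0 \<le> Q" using assms by simp
  have "0 < 2 / r * L" using assms by simp
  then have m_pos: "0 < m" by (simp add: m)
  have b_nonneg: "0 \<le> b" using assms by simp
  have Q2: "\<sigma>\<^sup>2 * (real T * (real T + 1)\<^sup>2) = Q\<^sup>2"
    by (simp add: Q power_mult_distrib)
  \<comment> \<open>\<open>u^2\<close> is the accumulated noise. Two bounds are played against each
    other: \<open>u \<le> C * D\<close>, from the maximum, and \<open>m * u \<le> Q\<close>, from
    \<open>m \<le> m + b\<close>.\<close>
  define u where "u = Q / (m + b)"
  have u: "0 \<le> u" using Q_nonneg m_pos b_nonneg by (simp add: u_def)
  have "Q = Q / (C * D) * (C * D)" using assms by simp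
  also have "\<dots> \<le> (m + b) * (C * D)"
    using b_nonneg assms(3,4) by (intro mult_right_mono) (auto simp: m)
  finally have u_le: "u \<le> C * D"
    using m_pos b_nonneg by (simp add: u_def pos_divide_le_eq ac_simps)
  have uu: "u\<^sup>2 \<le> C * D * u"
    using u u_le by (simp add: power2_eq_square mult_right_mono)
  have "m * u = Q * (m / (m + b))" by (simp add: u_def)
  also have "\<dots> \<le> Q * 1"
    using Q_nonneg m_pos b_nonneg by (intro mult_left_mono) auto
  finally have mu: "m * u \<le> Q" by simp
  have "m * (D\<^sup>2 + u\<^sup>2) \<le> (2 / r * L + Q / (C * D)) * D\<^sup>2 + C * D * (m * u)"
  proof -
    have "m \<le> 2 / r * L + Q / (C * D)"
      using Q_nonneg \<open>0 < 2 / r * L\<close> assms(3,4) unfolding m by auto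
    moreover have "m * u\<^sup>2 \<le> C * D * (m * u)"
      using mult_left_mono[OF uu, of m] m_pos by (simp add: ac_simps)
    ultimately show ?thesis
      unfolding distrib_left by (intro add_mono mult_right_mono) auto
  qed
  also have "\<dots> \<le> (2 / r * L + Q / (C * D)) * D\<^sup>2 + C * D * Q"
    using mu assms(3,4) by (intro add_mono mult_left_mono order_refl) auto
  also have "\<dots> = 2 / r * L * D\<^sup>2 + (1 / C + C) * Q * D"
    using assms(3,4) by (simp add: field_simps power2_eq_square)
  finally have 1: "m * (D\<^sup>2 + u\<^sup>2) \<le> 2 / r * L * D\<^sup>2 + (1 / C + C) * Q * D" .
  \<comment> \<open>In the part multiplied by \<open>b\<close> the bound on \<open>m * u\<close> is
    of no help; \<open>u^2\<close> is only reduced to \<open>C * D * u\<close>, and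
    \<open>D^2 + C * D * u\<close> is what the prefactor encodes.\<close>
  have "prefactor L K D T C r \<beta> \<sigma> * D\<^sup>2 = D\<^sup>2 + C * D * u"
  proof -
    have "C * Q / (n * D) * D\<^sup>2 = C * D * (Q / n)" for n
      using assms(3) by (simp add: power2_eq_square)
    then show ?thesis
      by (simp only: prefactor_eq[OF Q m b] u_def distrib_right[of 1] mult_1_left)
  qed
  then have 2: "D\<^sup>2 + u\<^sup>2 \<le> prefactor L K D T C r \<beta> \<sigma> * D\<^sup>2" (is "_ \<le> ?A * _")
    using uu by simp
  have "(m + b * real T) / (real T * (real T + 1)) * (D\<^sup>2 + u\<^sup>2) =
      (m * (D\<^sup>2 + u\<^sup>2) / real T + b * (D\<^sup>2 + u\<^sup>2)) / (real T + 1)"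
    using assms(8) by (simp add: field_simps)
  also have "\<dots> \<le> ((2 / r * L * D\<^sup>2 + (1 / C + C) * Q * D) / real T + b * (?A * D\<^sup>2)) / (real T + 1)"
    using 1 2 b_nonneg by (intro divide_right_mono add_mono mult_left_mono) auto
  also have "\<dots> = ((2 / r * L / real T + ?A * b) * D\<^sup>2 + (1 / C + C) * (Q / real T) * D) / (real T + 1)"
    by (simp add: add_divide_distrib distrib_right distrib_left ac_simps)
  \<comment> \<open>The factor \<open>T + 1\<close> of \<open>Q\<close> cancels the outer
    denominator, which leaves the rate \<open>1 / sqrt T\<close> for the noise.\<close>
  also have "Q / real T = (real T + 1) * \<sigma> / sqrt (real T)"
  proof -
    have "Q = \<sigma> * sqrt (real T) * (real T + 1)" by (simp add: Q real_sqrt_mult)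
    then show ?thesis
      using assms(8) by (simp add: real_div_sqrt field_simps)
  qed
  also have "((2 / r * L / real T + ?A * b) * D\<^sup>2 + (1 / C + C) * ((real T + 1) * \<sigma> / sqrt (real T)) * D) / (real T + 1)
     = (2 / r * L / real T + ?A * b) / (real T + 1) * D\<^sup>2 + (1 / C + C) * \<sigma> / sqrt (real T) * D"
  proof -
    have "(x * D\<^sup>2 + c * (n * \<sigma> / q) * D) / n = x / n * D\<^sup>2 + c * \<sigma> / q * D" if "n \<noteq> 0" for x c n q :: real
      using that by (simp add: add_divide_distrib)
    then show ?thesis by simp
  qed
  finally have "2 / \<mu> * ((m + b * real T) / (real T * (real T + 1)) * (D\<^sup>2 + u\<^sup>2)) \<le>
     2 / \<mu> * ((2 / r * L / real T + ?A * b) / (real T + 1) * D\<^sup>2 + (1 / C + C) * \<sigma> / sqrt (real T) * D)"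
    using assms(9) by (intro mult_left_mono) auto
  also have "\<dots> = 2 / (\<mu> * (real T + 1)) * (2 / r * L / real T + ?A * b) * D\<^sup>2
      + 2 * (1 / C + C) * \<sigma> / (\<mu> * sqrt (real T)) * D"
  proof -
    have "2 / \<mu> * (x / n * D\<^sup>2 + c * \<sigma> / q * D) = 2 / (\<mu> * n) * x * D\<^sup>2 + 2 * c * \<sigma> / (\<mu> * q) * D" for x c n q
      by (simp add: distrib_left)
    then show ?thesis .
  qed
  finally show ?thesis
    unfolding Q2 u_def b by (simp add: power_divide mult.assoc)
qed

section \<open>Rescaling, the Gram matrix and filtrations\<close>

text \<open>A first-order condition without derivatives: the choice \<open>d = - t * v\<close> with
  \<open>t\<close> so small that \<open>c * t < 1\<close> makes the expression negative unless
  \<open>v = 0\<close>. It serves both the saddle point and the top eigenvector.\<close>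

lemma first_order_zero:
  fixes v :: "'a::real_inner"
  assumes "\<And>d. 0 \<le> v \<bullet> d + c * (norm d)\<^sup>2"
  shows "v = 0"
proof -
  define t where "t = 1 / (\<bar>c\<bar> + 1)"
  have t: "0 < t" "c * t < 1" by (auto simp: t_def)
  have "0 \<le> v \<bullet> ((- t) *\<^sub>R v) + c * (norm ((- t) *\<^sub>R v))\<^sup>2" by (rule assms)
  also have "\<dots> = - t * (norm v)\<^sup>2 + c * (t\<^sup>2 * (norm v)\<^sup>2)"
    by (simp add: power_mult_distrib power2_norm_eq_inner[of v])
  also have "\<dots> = - (t * (1 - c * t)) * (norm v)\<^sup>2"
    by (simp add: left_diff_distrib right_diff_distrib power2_eq_square ac_simps)
  finally have "t * (1 - c * t) * (norm v)\<^sup>2 \<le> 0" by simp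
  moreover have "0 < t * (1 - c * t)" using t by simp
  ultimately show ?thesis
    by (metis mult_pos_pos not_le zero_less_norm_iff zero_less_power)
qed

section \<open>Operator norm and largest Gram eigenvalue of the coupling matrix\<close>

lemma inner_matrix_vector_transpose:
  fixes B :: "real^'m^'n"
  shows "x \<bullet> (B *v y) = (transpose B *v x) \<bullet> y"
  by (simp add: dot_lmul_matrix [symmetric] transpose_matrix_vector)

lemma norm_transpose_le:
  fixes B :: "real^'m^'n"
  assumes "\<And>y. (norm (B *v y))\<^sup>2 \<le> l * (norm y)\<^sup>2"
  shows "(norm (transpose B *v x))\<^sup>2 \<le> l * (norm x)\<^sup>2"
proof (cases "transpose B *v x = 0")
  case True
  obtain b :: "real^'m" where "b \<in> Basis" using nonempty_Basis by blast
  then have "0 \<le> l" using order_trans[OF zero_le_power2 assms[of b]] by (simp add: norm_Basis)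
  with True show ?thesis by simp
next
  case False
  let ?u = "transpose B *v x"
  have "(norm ?u)\<^sup>2 = x \<bullet> (B *v ?u)"
    by (simp add: power2_norm_eq_inner inner_matrix_vector_transpose)
  also have "\<dots> \<le> norm x * norm (B *v ?u)"
    by (rule norm_cauchy_schwarz)
  finally have "((norm ?u)\<^sup>2)\<^sup>2 \<le> (norm x * norm (B *v ?u))\<^sup>2"
    by (rule power_mono) simp
  also have "\<dots> \<le> (norm x)\<^sup>2 * (l * (norm ?u)\<^sup>2)"
    unfolding power_mult_distrib by (intro mult_left_mono assms) simp
  finally have "(norm ?u)\<^sup>2 * (norm ?u)\<^sup>2 \<le> (l * (norm x)\<^sup>2) * (norm ?u)\<^sup>2"
    by (simp add: power2_eq_square ac_simps)
  then show ?thesis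
    by (rule mult_right_le_imp_le) (use False in simp)
qed

text \<open>\<open>GREATEST\<close> says something only once a greatest eigenvalue is exhibited. It
  is the maximum \<open>l\<close> of \<open>(norm (B *v y))^2\<close> on the compact unit sphere,
  attained at \<open>v\<close>.\<close>

lemma lambda_max_gram:
  fixes B :: "real^'m^'n"
  shows "0 \<le> lambda_max (transpose B ** B)"
    and "(norm (B *v y))\<^sup>2 \<le> lambda_max (transpose B ** B) * (norm y)\<^sup>2"
proof -
  have "compact (sphere (0::real^'m) 1)" by simp
  moreover have "sphere (0::real^'m) 1 \<noteq> {}" by simp
  moreover have "continuous_on (sphere 0 1) (\<lambda>y. norm (B *v y))"
    by (intro continuous_intros linear_continuous_on matrix_vector_mul_bounded_linear)
  ultimately obtain v where v: "norm v = 1" and max: "\<And>y. norm y = 1 \<Longrightarrow> norm (B *v y) \<le> norm (B *v v)"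
    using continuous_attains_sup[of "sphere 0 1" "\<lambda>y. norm (B *v y)"] by auto
  define l where "l = (norm (B *v v))\<^sup>2"
  have le: "(norm (B *v y))\<^sup>2 \<le> l * (norm y)\<^sup>2" for y
  proof (cases "y = 0")
    case False
    have "B *v ((1 / norm y) *\<^sub>R y) = (1 / norm y) *\<^sub>R (B *v y)"
      by (rule matrix_vector_mult_scaleR)
    then have "norm (B *v y) / norm y \<le> norm (B *v v)"
      using max[of "(1 / norm y) *\<^sub>R y"] False by simp
    then have "norm (B *v y) \<le> norm (B *v v) * norm y"
      using False by (simp add: pos_divide_le_eq)
    then show ?thesis
      unfolding l_def power_mult_distrib[symmetric] by (rule power_mono) simp
  qed simp
  have gram: "(transpose B ** B) *v y = transpose B *v (B *v y)" for y
    by (rule matrix_vector_mul_assoc[symmetric])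
  \<comment> \<open>The quadratic form \<open>l * (norm y)^2 - (norm (B *v y))^2\<close> is
    nonnegative and vanishes at \<open>v\<close>, so its gradient vanishes there; this is the
    eigenvector equation.\<close>
  have "2 *\<^sub>R (l *\<^sub>R v - transpose B *v (B *v v)) = 0"
  proof (rule first_order_zero[where c=l])
    fix d
    have "0 \<le> l * (norm (v + d))\<^sup>2 - (norm (B *v v + B *v d))\<^sup>2"
      using le[of "v + d"] by (simp add: matrix_vector_right_distrib)
    also have "\<dots> = l * (norm v)\<^sup>2 - (norm (B *v v))\<^sup>2 + 2 * (l * (v \<bullet> d) - (B *v v) \<bullet> (B *v d))
        + l * (norm d)\<^sup>2 - (norm (B *v d))\<^sup>2"
      by (simp add: norm_add_square algebra_simps inner_commute)
    also have "\<dots> \<le> 2 *\<^sub>R (l *\<^sub>R v - transpose B *v (B *v v)) \<bullet> d + l * (norm d)\<^sup>2"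
      by (simp add: v l_def inner_diff_left inner_matrix_vector_transpose)
    finally show "0 \<le> 2 *\<^sub>R (l *\<^sub>R v - transpose B *v (B *v v)) \<bullet> d + l * (norm d)\<^sup>2" .
  qed
  then have eigen: "(transpose B ** B) *v v = l *\<^sub>R v" by (simp add: gram)
  have "lambda_max (transpose B ** B) = l"
    unfolding lambda_max_def
  proof (rule Greatest_equality)
    show "\<exists>v. v \<noteq> 0 \<and> (transpose B ** B) *v v = l *\<^sub>R v"
      using eigen v by (intro exI[of _ v]) auto
    fix k assume "\<exists>u. u \<noteq> 0 \<and> (transpose B ** B) *v u = k *\<^sub>R u"
    then obtain u where u: "u \<noteq> 0" "transpose B *v (B *v u) = k *\<^sub>R u" by (auto simp: gram)
    have "k * (norm u)\<^sup>2 = (norm (B *v u))\<^sup>2"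
      using inner_matrix_vector_transpose[of "B *v u" B u] u(2) by (simp add: power2_norm_eq_inner)
    also have "\<dots> \<le> l * (norm u)\<^sup>2" by (rule le)
    finally show "k \<le> l" using u(1) by (simp add: mult_le_cancel_right)
  qed
  then show "0 \<le> lambda_max (transpose B ** B)" "(norm (B *v y))\<^sup>2 \<le> lambda_max (transpose B ** B) * (norm y)\<^sup>2"
    using le by (simp_all add: l_def)
qed

text \<open>The substitution \<open>(x, y) \<mapsto> (x, c *\<^sub>R y)\<close> with \<open>c\<^sup>2 = R\<close> turns the weighted norm into the
  Euclidean one and a pair of partial gradients into \<open>rescale c u v\<close>.\<close>

definition rescale :: "real \<Rightarrow> ('a::real_vector \<Rightarrow> 'b::real_vector \<Rightarrow> 'a) \<Rightarrow> ('a \<Rightarrow> 'b \<Rightarrow> 'b) \<Rightarrow> 'a \<times> 'b \<Rightarrow> 'a \<times> 'b" where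
  "rescale c u v p = (u (fst p) (snd p /\<^sub>R c), v (fst p) (snd p /\<^sub>R c) /\<^sub>R c)"

text \<open>For \<open>c^2 = R\<close> the right-hand side is the weighted error of the two variance
  assumptions.\<close>

lemma norm_rescale_diff:
  fixes u :: "'a::euclidean_space \<Rightarrow> 'b::euclidean_space \<Rightarrow> 'a"
  shows "(norm (rescale c u v p - rescale c u' v' p))\<^sup>2 =
    (norm (u (fst p) (snd p /\<^sub>R c) - u' (fst p) (snd p /\<^sub>R c)))\<^sup>2
    + 1 / c\<^sup>2 * (norm (v (fst p) (snd p /\<^sub>R c) - v' (fst p) (snd p /\<^sub>R c)))\<^sup>2"
proof -
  have "y /\<^sub>R c - y' /\<^sub>R c = (y - y') /\<^sub>R c" for y y' :: 'b
    by (simp add: scaleR_diff_right)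
  then show ?thesis
    by (simp add: rescale_def norm_Pair power_mult_distrib power_divide inverse_eq_divide)
qed

lemma unbiased_oracle_compose:
  assumes "unbiased_oracle D orc G" and \<phi>[measurable]: "\<phi> \<in> measurable borel borel"
  shows "unbiased_oracle D (\<lambda>p. orc (\<phi> p)) (\<lambda>p. G (\<phi> p))"
proof -
  have 1: "(\<lambda>q. (\<phi> (fst q), snd q)) \<in> measurable (borel \<Otimes>\<^sub>M D) (borel \<Otimes>\<^sub>M D)"
    by simp
  have 2: "(\<lambda>q. orc (fst q) (snd q)) \<in> borel_measurable (borel \<Otimes>\<^sub>M D)"
    using assms(1) by (simp add: unbiased_oracle_def case_prod_unfold)
  from measurable_compose[OF 1 2] have "(\<lambda>(p, s). orc (\<phi> p) s) \<in> borel_measurable (borel \<Otimes>\<^sub>M D)"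
    by (simp add: case_prod_unfold)
  then show ?thesis
    using assms(1) by (simp add: unbiased_oracle_def)
qed

lemma unbiased_oracle_minus:
  assumes "unbiased_oracle D orc G"
  shows "unbiased_oracle D (\<lambda>p s. - orc p s) (\<lambda>p. - G p)"
  using assms by (simp add: unbiased_oracle_def case_prod_unfold)

lemma unbiased_oracle_rescale:
  fixes u :: "'a::euclidean_space \<Rightarrow> 'b::euclidean_space \<Rightarrow> 's \<Rightarrow> 'a"
  assumes u: "unbiased_oracle D (\<lambda>(x, y). u x y) (\<lambda>(x, y). U x y)"
    and v: "unbiased_oracle D (\<lambda>(x, y). v x y) (\<lambda>(x, y). V x y)"
  shows "unbiased_oracle D (\<lambda>p s. rescale c (\<lambda>x y. u x y s) (\<lambda>x y. v x y s) p) (rescale c U V)"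
proof -
  have \<phi>: "(\<lambda>p. (fst p, snd p /\<^sub>R c)) \<in> borel_measurable (borel :: ('a \<times> 'b) measure)"
    by (intro borel_measurable_continuous_onI continuous_intros)
  note u' = unbiased_oracle_compose[OF u \<phi>] and v' = unbiased_oracle_compose[OF v \<phi>]
  have bl: "bounded_linear (\<lambda>x::'a. (x, 0::'b))" "bounded_linear (\<lambda>y::'b. (0::'a, y /\<^sub>R c))"
    by (intro bounded_linear_Pair bounded_linear_ident bounded_linear_zero bounded_linear_scaleR_right)+
  \<comment> \<open>Each component is sent into the product by a bounded linear embedding, and the
    Bochner integral commutes with these.\<close>
  have split: "rescale c (\<lambda>x y. u x y s) (\<lambda>x y. v x y s) p =
      (u (fst p) (snd p /\<^sub>R c) s, 0) + (0, v (fst p) (snd p /\<^sub>R c) s /\<^sub>R c)" for p s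
    by (simp add: rescale_def)
  have int: "integrable D (u (fst p) (snd p /\<^sub>R c))" "integrable D (v (fst p) (snd p /\<^sub>R c))" for p
    using u' v' by (auto simp: unbiased_oracle_def)
  have mean: "(\<integral>s. u (fst p) (snd p /\<^sub>R c) s \<partial>D) = U (fst p) (snd p /\<^sub>R c)"
    "(\<integral>s. v (fst p) (snd p /\<^sub>R c) s \<partial>D) = V (fst p) (snd p /\<^sub>R c)" for p
    using u' v' by (auto simp: unbiased_oracle_def)
  note ib = integrable_bounded_linear[OF bl(1) int(1)] integrable_bounded_linear[OF bl(2) int(2)]
  show ?thesis
    unfolding unbiased_oracle_def
  proof (intro conjI allI)
    show "(\<lambda>(p, s). rescale c (\<lambda>x y. u x y s) (\<lambda>x y. v x y s) p) \<in> borel_measurable (borel \<Otimes>\<^sub>M D)"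
      unfolding rescale_def case_prod_unfold
      by (intro borel_measurable_Pair borel_measurable_scaleR measurable_const)
        (use u' v' in \<open>simp_all add: unbiased_oracle_def case_prod_unfold\<close>)
    fix p
    show "integrable D (\<lambda>s. rescale c (\<lambda>x y. u x y s) (\<lambda>x y. v x y s) p)"
      unfolding split by (intro Bochner_Integration.integrable_add ib)
    show "(\<integral>s. rescale c (\<lambda>x y. u x y s) (\<lambda>x y. v x y s) p \<partial>D) = rescale c U V p"
      unfolding split Bochner_Integration.integral_add[OF ib]
        integral_bounded_linear[OF bl(1) int(1)] integral_bounded_linear[OF bl(2) int(2)] mean
      by (simp add: rescale_def)
  qed
qed

section \<open>Sigma-algebras generated by groups of independent sources\<close>

definition joint_algebra :: "'w measure \<Rightarrow> ('i \<Rightarrow> 'w measure) \<Rightarrow> 'i set \<Rightarrow> 'w measure" where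
  "joint_algebra M V J = sigma (space M) (\<Union>j\<in>J. sets (V j))"

context
  fixes M :: "'w measure" and V :: "'i \<Rightarrow> 'w measure" and I :: "'i set"
  assumes space: "\<And>i. i \<in> I \<Longrightarrow> space (V i) = space M"
begin

lemma sets_joint_algebra:
  assumes "J \<subseteq> I"
  shows "sets (joint_algebra M V J) = sigma_sets (space M) (\<Union>j\<in>J. sets (V j))"
  unfolding joint_algebra_def
  using assms space sets.space_closed by (intro sets_measure_of) blast

lemma space_joint_algebra: "space (joint_algebra M V J) = space M"
  by (simp add: joint_algebra_def space_measure_of_conv)

lemma subalgebra_joint_algebra:
  assumes "J \<subseteq> I" "\<And>j. j \<in> J \<Longrightarrow> sets (V j) \<subseteq> sets M"
  shows "subalgebra M (joint_algebra M V J)"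
  unfolding subalgebra_def sets_joint_algebra[OF assms(1)] space_joint_algebra
  using assms(2) by (auto intro!: sets.sigma_sets_subset)

lemma joint_algebra_mono:
  assumes "J \<subseteq> J'" "J' \<subseteq> I"
  shows "subalgebra (joint_algebra M V J') (joint_algebra M V J)"
  unfolding subalgebra_def space_joint_algebra
    sets_joint_algebra[OF assms(2)] sets_joint_algebra[OF order_trans[OF assms]]
  using assms by (auto intro!: sigma_sets_mono')

lemma measurable_joint_algebra:
  assumes "J \<subseteq> I" "j \<in> J" and X: "X \<in> measurable (V j) N"
  shows "X \<in> measurable (joint_algebra M V J) N"
proof (rule measurable_from_subalg[OF _ X])
  show "subalgebra (joint_algebra M V J) (V j)"
    unfolding subalgebra_def space_joint_algebra sets_joint_algebra[OF assms(1)]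
    using assms space by auto
qed

text \<open>Disjoint groups of an independent family generate independent sigma-algebras, as the
  generators are stable under intersection. \<open>case_bool\<close> presents the groups
  \<open>J\<close> and \<open>{k}\<close> in the Boolean indexing of
  \<open>indep_set\<close>.\<close>

lemma indep_joint_algebra:
  assumes "prob_space M" and indep: "prob_space.indep_sets M (\<lambda>i. sets (V i)) I"
    and "J \<subseteq> I" "k \<in> I" "k \<notin> J"
  shows "prob_space.indep_set M (sets (joint_algebra M V J)) (sets (V k))"
proof -
  interpret prob_space M by fact
  have "indep_sets (\<lambda>b. sigma_sets (space M) (\<Union>i\<in>case_bool J {k} b. sets (V i))) UNIV"
  proof (rule indep_sets_collect_sigma)
    show "indep_sets (\<lambda>i. sets (V i)) (\<Union>b. case_bool J {k} b)"
      using assms by (intro indep_sets_mono_index[OF _ indep]) (auto split: bool.splits)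
    show "disjoint_family_on (case_bool J {k}) UNIV"
      using assms by (auto simp: disjoint_family_on_def split: bool.splits)
  qed (rule sets.Int_stable)
  then show ?thesis
    unfolding indep_set_def sets_joint_algebra[OF assms(3)]
    by (rule indep_sets_mono_sets) (auto split: bool.splits)
qed

end

section \<open>The saddle point problem\<close>

lemma smooth_strongly_convexD:
  assumes "smooth_strongly_convex \<mu> L F"
  shows "\<mu> / 2 * (norm (x - x'))\<^sup>2 \<le> F x - F x' - grad F x' \<bullet> (x - x')"
    and "F x - F x' - grad F x' \<bullet> (x - x') \<le> L / 2 * (norm (x - x'))\<^sup>2"
  using assms by (auto simp: smooth_strongly_convex_def)

lemma smooth_strongly_convex_measurable:
  fixes F :: "'a::euclidean_space \<Rightarrow> real"
  assumes "smooth_strongly_convex \<mu> L F"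
  shows "F \<in> borel_measurable borel"
  using assms unfolding smooth_strongly_convex_def
  by (intro borel_measurable_continuous_onI continuous_at_imp_continuous_on)
    (auto intro: differentiable_imp_continuous_within)

text \<open>Moving one block by \<open>d\<close> changes the coupling linearly and \<open>F\<close>
  or \<open>G\<close> by at most its gradient term plus a quadratic, so optimality takes the form
  required by \<open>first_order_zero\<close>.\<close>

lemma saddle_point_stationary:
  fixes B :: "real^'m^'n"
  assumes F: "smooth_strongly_convex \<mu>F LF F" and G: "smooth_strongly_convex \<mu>G LG G"
    and saddle: "saddle_point (\<lambda>x y. F x + coupling B ux uy x y - G y) wx wy"
  shows "grad F wx + (B *v wy - ux) = 0" "grad G wy - (transpose B *v wx + uy) = 0"
proof -
  have bil: "d \<bullet> (B *v y) = (transpose B *v d) \<bullet> y" for d y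
    by (rule inner_matrix_vector_transpose)
  show "grad F wx + (B *v wy - ux) = 0"
  proof (rule first_order_zero[where c="LF / 2"])
    fix d
    have "F wx + coupling B ux uy wx wy \<le> F (wx + d) + coupling B ux uy (wx + d) wy"
      using saddle by (auto simp: saddle_point_def)
    moreover have "F (wx + d) - F wx - grad F wx \<bullet> d \<le> LF / 2 * (norm d)\<^sup>2"
      using smooth_strongly_convexD(2)[OF F, of "wx + d" wx] by simp
    moreover have "coupling B ux uy (wx + d) wy = coupling B ux uy wx wy + (B *v wy - ux) \<bullet> d"
      by (simp add: coupling_def algebra_simps inner_commute)
    ultimately show "0 \<le> (grad F wx + (B *v wy - ux)) \<bullet> d + LF / 2 * (norm d)\<^sup>2"
      unfolding inner_add_left by linarith
  qed
  show "grad G wy - (transpose B *v wx + uy) = 0"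
  proof (rule first_order_zero[where c="LG / 2"])
    fix d
    have "coupling B ux uy wx (wy + d) - G (wy + d) \<le> coupling B ux uy wx wy - G wy"
      using saddle by (auto simp: saddle_point_def)
    moreover have "G (wy + d) - G wy - grad G wy \<bullet> d \<le> LG / 2 * (norm d)\<^sup>2"
      using smooth_strongly_convexD(2)[OF G, of "wy + d" wy] by simp
    ultimately show "0 \<le> (grad G wy - (transpose B *v wx + uy)) \<bullet> d + LG / 2 * (norm d)\<^sup>2"
      by (simp add: coupling_def inner_add_left inner_diff_left inner_add_right bil)
  qed
qed

text \<open>The choice \<open>c^2 = \<mu>G / \<mu>F\<close> gives both blocks the same modulus
  \<open>\<mu>F\<close>. It multiplies \<open>LG\<close> by \<open>\<mu>F / \<mu>G\<close> and
  divides \<open>B\<close> by \<open>c\<close>, which is the origin of the two rescaled constants.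
  The minus sign in the second block encodes ascent in \<open>y\<close> and makes the coupling field
  skew.\<close>

lemma skew_composite_saddle:
  fixes F :: "real^'n \<Rightarrow> real" and G :: "real^'m \<Rightarrow> real" and B :: "real^'m^'n"
  assumes F: "smooth_strongly_convex \<mu>F LF F" and G: "smooth_strongly_convex \<mu>G LG G"
    and \<mu>: "\<mu>F > 0" "\<mu>G > 0" and c: "c > 0" "c\<^sup>2 = \<mu>G / \<mu>F"
    and saddle: "saddle_point (\<lambda>x y. F x + coupling B ux uy x y - G y) wx wy"
  shows "skew_composite (\<lambda>p. F (fst p) + G (snd p /\<^sub>R c))
    (rescale c (\<lambda>x y. grad F x) (\<lambda>x y. grad G y))
    (rescale c (\<lambda>x y. B *v y - ux) (\<lambda>x y. - (transpose B *v x + uy)))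
    \<mu>F (max LF (\<mu>F / \<mu>G * LG)) (sqrt (lambda_max (transpose B ** B) * (\<mu>F / \<mu>G))) (wx, c *\<^sub>R wy)"
proof unfold_locales
  fix p q :: "(real^'n) \<times> (real^'m)"
  define dx where "dx = fst p - fst q"
  define dy where "dy = snd p - snd q"
  have norm_pq: "(norm (p - q))\<^sup>2 = (norm dx)\<^sup>2 + (norm dy)\<^sup>2"
    by (simp add: dx_def dy_def norm_prod_def)
  have dy_c: "snd p /\<^sub>R c - snd q /\<^sub>R c = dy /\<^sub>R c"
    by (simp add: dy_def scaleR_diff_right)
  have norm_dy: "(norm (dy /\<^sub>R c))\<^sup>2 = \<mu>F / \<mu>G * (norm dy)\<^sup>2"
    using c(1) by (simp add: power_mult_distrib power_inverse c(2))
  have eq: "F (fst p) + G (snd p /\<^sub>R c) - (F (fst q) + G (snd q /\<^sub>R c))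
      - rescale c (\<lambda>x y. grad F x) (\<lambda>x y. grad G y) q \<bullet> (p - q)
    = (F (fst p) - F (fst q) - grad F (fst q) \<bullet> dx)
      + (G (snd p /\<^sub>R c) - G (snd q /\<^sub>R c) - grad G (snd q /\<^sub>R c) \<bullet> (dy /\<^sub>R c))"
    by (simp add: rescale_def inner_prod_def dx_def dy_def)
  note Fb = smooth_strongly_convexD[OF F, of "fst p" "fst q", folded dx_def]
  note Gb = smooth_strongly_convexD[OF G, of "snd p /\<^sub>R c" "snd q /\<^sub>R c", unfolded dy_c norm_dy]
  have "\<mu>F / 2 * (norm (p - q))\<^sup>2 = \<mu>F / 2 * (norm dx)\<^sup>2 + \<mu>G / 2 * (\<mu>F / \<mu>G * (norm dy)\<^sup>2)"
    unfolding norm_pq distrib_left using \<mu> by simp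
  then show "\<mu>F / 2 * (norm (p - q))\<^sup>2 \<le> F (fst p) + G (snd p /\<^sub>R c) - (F (fst q) + G (snd q /\<^sub>R c))
      - rescale c (\<lambda>x y. grad F x) (\<lambda>x y. grad G y) q \<bullet> (p - q)"
    unfolding eq using Fb(1) Gb(1) by simp
  let ?L = "max LF (\<mu>F / \<mu>G * LG)"
  have "LF / 2 * (norm dx)\<^sup>2 \<le> ?L / 2 * (norm dx)\<^sup>2" "(\<mu>F / \<mu>G * LG) / 2 * (norm dy)\<^sup>2 \<le> ?L / 2 * (norm dy)\<^sup>2"
    by (intro mult_right_mono; simp)+
  moreover have "LG / 2 * (\<mu>F / \<mu>G * (norm dy)\<^sup>2) = (\<mu>F / \<mu>G * LG) / 2 * (norm dy)\<^sup>2"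
    by (simp add: ac_simps)
  ultimately show "F (fst p) + G (snd p /\<^sub>R c) - (F (fst q) + G (snd q /\<^sub>R c))
      - rescale c (\<lambda>x y. grad F x) (\<lambda>x y. grad G y) q \<bullet> (p - q) \<le> ?L / 2 * (norm (p - q))\<^sup>2"
    unfolding eq norm_pq distrib_left using Fb(2) Gb(2) by linarith
  let ?h = "rescale c (\<lambda>x y. B *v y - ux) (\<lambda>x y. - (transpose B *v x + uy))"
  have "?h p - ?h q = (B *v (snd p /\<^sub>R c) - B *v (snd q /\<^sub>R c), - ((transpose B *v fst p - transpose B *v fst q) /\<^sub>R c))"
    by (simp add: rescale_def algebra_simps)
  then have diff: "?h p - ?h q = (B *v (dy /\<^sub>R c), - ((transpose B *v dx) /\<^sub>R c))"
    by (simp add: dx_def dy_c[symmetric] matrix_vector_mult_diff_distrib)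
  have "p - q = (dx, dy)" by (simp add: dx_def dy_def prod_eq_iff)
  then show "(?h p - ?h q) \<bullet> (p - q) = 0"
    unfolding diff using inner_matrix_vector_transpose[of dx B dy]
    by (simp add: matrix_vector_mult_scaleR inner_commute)
  let ?l = "lambda_max (transpose B ** B)"
  have "(norm (?h p - ?h q))\<^sup>2 = (norm (B *v dy))\<^sup>2 * (\<mu>F / \<mu>G) + (norm (transpose B *v dx))\<^sup>2 * (\<mu>F / \<mu>G)"
    unfolding diff using c(1) \<mu> by (simp add: norm_Pair matrix_vector_mult_scaleR power_mult_distrib power_inverse c(2) ac_simps)
  also have "\<dots> \<le> (?l * (norm dy)\<^sup>2) * (\<mu>F / \<mu>G) + (?l * (norm dx)\<^sup>2) * (\<mu>F / \<mu>G)"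
    using \<mu> by (intro add_mono mult_right_mono lambda_max_gram norm_transpose_le) auto
  also have "\<dots> = (sqrt (?l * (\<mu>F / \<mu>G)) * norm (p - q))\<^sup>2"
    unfolding power_mult_distrib norm_pq using lambda_max_gram(1)[of B] \<mu> by (simp add: algebra_simps)
  finally show "norm (?h p - ?h q) \<le> sqrt (?l * (\<mu>F / \<mu>G)) * norm (p - q)"
    by (rule power2_le_imp_le) (use lambda_max_gram(1)[of B] \<mu> in simp)
next
  show "0 < \<mu>F" by (rule \<mu>)
  have m: "(\<lambda>p. snd p /\<^sub>R c) \<in> borel_measurable (borel :: ((real^'n) \<times> (real^'m)) measure)"
      "fst \<in> borel_measurable (borel :: ((real^'n) \<times> (real^'m)) measure)"
    by (intro borel_measurable_continuous_onI continuous_intros)+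
  show "(\<lambda>p. F (fst p) + G (snd p /\<^sub>R c)) \<in> borel_measurable borel"
    by (intro borel_measurable_add measurable_compose[OF m(1)] measurable_compose[OF m(2)]
        smooth_strongly_convex_measurable[OF F] smooth_strongly_convex_measurable[OF G])
  show "rescale c (\<lambda>x y. grad F x) (\<lambda>x y. grad G y) (wx, c *\<^sub>R wy)
      + rescale c (\<lambda>x y. B *v y - ux) (\<lambda>x y. - (transpose B *v x + uy)) (wx, c *\<^sub>R wy) = 0"
    using saddle_point_stationary[OF F G saddle] c(1)
    by (simp add: rescale_def zero_prod_def flip: scaleR_right_distrib)
qed

text \<open>For positive \<open>s\<close> this closes the recursive step; for \<open>s = 0\<close>
  all three points coincide, so any weight will do.\<close>

lemma ag_eg_md:
  assumes "S = ag_eg \<alpha> \<eta> R gf gg hx hy x0 y0 \<xi> \<zeta>h \<zeta> s"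
  shows "mdx S = (1 - \<alpha> (Suc s)) *\<^sub>R agx S + \<alpha> (Suc s) *\<^sub>R itx S"
    and "mdy S = (1 - \<alpha> (Suc s)) *\<^sub>R agy S + \<alpha> (Suc s) *\<^sub>R ity S"
proof -
  have "mdx S = (1 - \<alpha> (Suc s)) *\<^sub>R agx S + \<alpha> (Suc s) *\<^sub>R itx S \<and> mdy S = (1 - \<alpha> (Suc s)) *\<^sub>R agy S + \<alpha> (Suc s) *\<^sub>R ity S"
    unfolding assms by (cases s) (simp_all add: Let_def flip: scaleR_left_distrib)
  then show "mdx S = (1 - \<alpha> (Suc s)) *\<^sub>R agx S + \<alpha> (Suc s) *\<^sub>R itx S"
    and "mdy S = (1 - \<alpha> (Suc s)) *\<^sub>R agy S + \<alpha> (Suc s) *\<^sub>R ity S" by auto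
qed

definition source_algebra ::
    "'w measure \<Rightarrow> 's measure \<Rightarrow> 'z measure \<Rightarrow> ('w \<Rightarrow> 'a::topological_space) \<Rightarrow> ('w \<Rightarrow> 'b::topological_space) \<Rightarrow>
     (nat \<Rightarrow> 'w \<Rightarrow> 's) \<Rightarrow> (nat \<Rightarrow> 'w \<Rightarrow> 'z) \<Rightarrow> (nat \<Rightarrow> 'w \<Rightarrow> 'z) \<Rightarrow> source \<Rightarrow> 'w measure" where
  "source_algebra M D\<xi> D\<zeta> x0 y0 \<xi> \<zeta>h \<zeta> i = (case i of
      Init \<Rightarrow> vimage_algebra (space M) (\<lambda>w. (x0 w, y0 w)) borel
    | Xi t \<Rightarrow> vimage_algebra (space M) (\<xi> t) D\<xi>
    | Zeta_half t \<Rightarrow> vimage_algebra (space M) (\<zeta>h t) D\<zeta>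
    | Zeta t \<Rightarrow> vimage_algebra (space M) (\<zeta> t) D\<zeta>)"

lemma source_algebra_simps [simp]:
  "source_algebra M D\<xi> D\<zeta> x0 y0 \<xi> \<zeta>h \<zeta> Init = vimage_algebra (space M) (\<lambda>w. (x0 w, y0 w)) borel"
  "source_algebra M D\<xi> D\<zeta> x0 y0 \<xi> \<zeta>h \<zeta> (Xi t) = vimage_algebra (space M) (\<xi> t) D\<xi>"
  "source_algebra M D\<xi> D\<zeta> x0 y0 \<xi> \<zeta>h \<zeta> (Zeta_half t) = vimage_algebra (space M) (\<zeta>h t) D\<zeta>"
  "source_algebra M D\<xi> D\<zeta> x0 y0 \<xi> \<zeta>h \<zeta> (Zeta t) = vimage_algebra (space M) (\<zeta> t) D\<zeta>"
  by (simp_all add: source_algebra_def)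

lemma space_source_algebra: "space (source_algebra M D\<xi> D\<zeta> x0 y0 \<xi> \<zeta>h \<zeta> i) = space M"
  by (cases i) simp_all

definition past :: "nat \<Rightarrow> source set" where
  "past s = {Init} \<union> Xi ` {1..s} \<union> Zeta_half ` {1..s} \<union> Zeta ` {1..s}"

text \<open>The sources that determine the half iterate of step \<open>Suc s\<close>, just before
  \<open>Zeta (Suc s)\<close> is revealed.\<close>

definition past_half :: "nat \<Rightarrow> source set" where
  "past_half s = past s \<union> {Xi (Suc s), Zeta_half (Suc s)}"

lemma past_subsets:
  "s \<le> T \<Longrightarrow> past s \<subseteq> past T" "s < T \<Longrightarrow> past_half s \<subseteq> past T"
  "past s \<subseteq> past_half s" "past_half s \<subseteq> past (Suc s)"
  by (auto simp: past_def past_half_def)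

lemma fresh_sources:
  "Xi (Suc s) \<notin> past s" "Zeta_half (Suc s) \<notin> past s" "Zeta (Suc s) \<notin> past_half s"
  "Xi (Suc s) \<in> past_half s" "Zeta_half (Suc s) \<in> past_half s" "Zeta (Suc s) \<in> past (Suc s)"
  by (auto simp: past_def past_half_def)

theorem theorem4p1:
  fixes F :: "real^'n \<Rightarrow> real" and G :: "real^'m \<Rightarrow> real"
    and B :: "real^'m^'n" and ux :: "real^'n" and uy :: "real^'m"
    and H :: "real^'n \<Rightarrow> real^'m \<Rightarrow> real"
    and \<mu>F LF \<mu>G LG :: real
    and wx :: "real^'n" and wy :: "real^'m"
    and D\<xi> :: "'s measure" and D\<zeta> :: "'z measure"
    and gf :: "real^'n \<Rightarrow> 's \<Rightarrow> real^'n" and gg :: "real^'m \<Rightarrow> 's \<Rightarrow> real^'m"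
    and hx :: "real^'n \<Rightarrow> real^'m \<Rightarrow> 'z \<Rightarrow> real^'n"
    and hy :: "real^'n \<Rightarrow> real^'m \<Rightarrow> 'z \<Rightarrow> real^'m"
    and \<sigma>_Str \<sigma>_Bil L_Str L_Bil \<mu>_Str R r \<beta> C \<sigma> D0 :: real
    and T :: nat
    and M :: "'w measure"
    and x0 :: "'w \<Rightarrow> real^'n" and y0 :: "'w \<Rightarrow> real^'m"
    and \<xi> :: "nat \<Rightarrow> 'w \<Rightarrow> 's" and \<zeta>h \<zeta> :: "nat \<Rightarrow> 'w \<Rightarrow> 'z"
    and \<alpha> \<eta> :: "nat \<Rightarrow> real"
    and out :: "'w \<Rightarrow> (real^'n, real^'m) ag_eg_state"
  assumes dims: "CARD('n) \<ge> CARD('m)"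
    and H_def: "H = coupling B ux uy"
    and F: "smooth_strongly_convex \<mu>F LF F" and \<mu>F: "\<mu>F > 0"
    and G: "smooth_strongly_convex \<mu>G LG G" and \<mu>G: "\<mu>G > 0"
    and saddle: "\<And>x y. saddle_point (\<lambda>x y. F x + H x y - G y) x y \<longleftrightarrow> x = wx \<and> y = wy"
    and L_Str_def: "L_Str = max LF (\<mu>F / \<mu>G * LG)"
    and L_Bil_def: "L_Bil = sqrt (lambda_max (transpose B ** B) * (\<mu>F / \<mu>G))"
    and \<mu>_Str_def: "\<mu>_Str = \<mu>F"
    and R_def: "R = \<mu>G / \<mu>F"
    and D\<xi>: "prob_space D\<xi>" and D\<zeta>: "prob_space D\<zeta>"
    and gf: "unbiased_oracle D\<xi> gf (grad F)"
    and gg: "unbiased_oracle D\<xi> gg (grad G)"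
    and hx: "unbiased_oracle D\<zeta> (\<lambda>(x, y). hx x y) (\<lambda>(x, y). grad (\<lambda>x'. H x' y) x)"
    and hy: "unbiased_oracle D\<zeta> (\<lambda>(x, y). hy x y) (\<lambda>(x, y). grad (\<lambda>y'. H x y') y)"
    and var_Str: "\<And>x y. mean_le D\<xi>
          (\<lambda>s. (norm (gf x s - grad F x))\<^sup>2 + 1 / R * (norm (gg y s - grad G y))\<^sup>2) (\<sigma>_Str\<^sup>2)"
    and var_Bil: "\<And>x y. mean_le D\<zeta>
          (\<lambda>z. (norm (hx x y z - grad (\<lambda>x'. H x' y) x))\<^sup>2
             + 1 / R * (norm (hy x y z - grad (\<lambda>y'. H x y') y))\<^sup>2) (\<sigma>_Bil\<^sup>2)"
    and T: "T \<ge> 1" and r: "0 < r" "r < 1" and \<beta>: "\<beta> > 0" and C: "C > 0"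
    and \<sigma>_def: "\<sigma> = 1 / sqrt 3 * sqrt (1 / (1 - r) * \<sigma>_Str\<^sup>2 + (2 + 1 / \<beta>) * \<sigma>_Bil\<^sup>2)"
    and M: "prob_space M"
    and x0: "x0 \<in> borel_measurable M" "integrable M (\<lambda>w. (norm (x0 w))\<^sup>2)"
    and y0: "y0 \<in> borel_measurable M" "integrable M (\<lambda>w. (norm (y0 w))\<^sup>2)"
    and sampling: "independent_sampling M D\<xi> D\<zeta> T x0 y0 \<xi> \<zeta>h \<zeta>"
    and D0: "D0\<^sup>2 = (\<integral>w. (norm (x0 w - wx))\<^sup>2 + R * (norm (y0 w - wy))\<^sup>2 \<partial>M)" "D0 > 0"
    and \<alpha>_def: "\<alpha> = (\<lambda>t. 2 / (real t + 1))"
    and \<eta>_def: "\<eta> = eta_bar L_Str L_Bil D0 T C r \<beta> \<sigma>"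
    and out_def: "out = (\<lambda>w. ag_eg \<alpha> \<eta> R gf gg hx hy (x0 w) (y0 w)
                                (\<lambda>t. \<xi> t w) (\<lambda>t. \<zeta>h t w) (\<lambda>t. \<zeta> t w) T)"
  shows "mean_le M (\<lambda>w. (norm (agx (out w) - wx))\<^sup>2 + R * (norm (agy (out w) - wy))\<^sup>2)
           (2 / (\<mu>_Str * (real T + 1))
              * (2 / r * L_Str / real T
                 + prefactor L_Str L_Bil D0 T C r \<beta> \<sigma> * sqrt ((1 + \<beta>) / r) * L_Bil) * D0\<^sup>2
            + 2 * (1 / C + C) * \<sigma> / (\<mu>_Str * sqrt (real T)) * D0)
         \<and> (\<forall>s\<ge>0. prefactor L_Str L_Bil D0 T C r \<beta> s \<in> {1..1 + C\<^sup>2})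
         \<and> prefactor L_Str L_Bil D0 T C r \<beta> 0 = 1"
proof -
  define c where "c = sqrt R"
  have R_pos: "0 < R" using \<mu>F \<mu>G by (simp add: R_def)
  have c: "0 < c" "c\<^sup>2 = R" using R_pos by (simp_all add: c_def)
  interpret M: prob_space M by (rule M)
  define V where "V = source_algebra M D\<xi> D\<zeta> x0 y0 \<xi> \<zeta>h \<zeta>"
  define A where "A s = joint_algebra M V (past s)" for s
  define A' where "A' s = joint_algebra M V (past_half s)" for s
  have V_space: "space (V i) = space M" for i by (simp add: V_def space_source_algebra)
  have "(\<lambda>i. case i of
              Init \<Rightarrow> sets (vimage_algebra (space M) (\<lambda>w. (x0 w, y0 w)) borel)
            | Xi t \<Rightarrow> sets (vimage_algebra (space M) (\<xi> t) D\<xi>)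
            | Zeta_half t \<Rightarrow> sets (vimage_algebra (space M) (\<zeta>h t) D\<zeta>)
            | Zeta t \<Rightarrow> sets (vimage_algebra (space M) (\<zeta> t) D\<zeta>)) = (\<lambda>i. sets (V i))"
    unfolding V_def source_algebra_def by (rule ext) (simp split: source.splits)
  then have V_indep: "M.indep_sets (\<lambda>i. sets (V i)) (past T)"
    using sampling unfolding independent_sampling_def past_def by simp
  then have V_events: "i \<in> past T \<Longrightarrow> sets (V i) \<subseteq> sets M" for i
    unfolding M.indep_sets_def by blast
  have sample: "\<xi> t \<in> measurable M D\<xi>" "distr M D\<xi> (\<xi> t) = D\<xi>" "\<zeta>h t \<in> measurable M D\<zeta>"
    "distr M D\<zeta> (\<zeta>h t) = D\<zeta>" "\<zeta> t \<in> measurable M D\<zeta>" "distr M D\<zeta> (\<zeta> t) = D\<zeta>" if "t \<in> {1..T}" for t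
    using sampling that unfolding independent_sampling_def by blast+
  have fresh_in: "Xi (Suc s) \<in> past T" "Zeta_half (Suc s) \<in> past T" "Zeta (Suc s) \<in> past T" if "s < T" for s
    using that by (auto simp: past_def)

  define f where "f p = F (fst p) + G (snd p /\<^sub>R c)" for p
  define g where "g = rescale c (\<lambda>x y. grad F x) (\<lambda>x y. grad G y)"
  define h where "h = rescale c (\<lambda>x y. B *v y - ux) (\<lambda>x y. - (transpose B *v x + uy))"
  define og where "og p s = rescale c (\<lambda>x y. gf x s) (\<lambda>x y. gg y s) p" for p s
  define oh where "oh p s = rescale c (\<lambda>x y. hx x y s) (\<lambda>x y. - hy x y s) p" for p s
  define S where "S s w = ag_eg \<alpha> \<eta> R gf gg hx hy (x0 w) (y0 w) (\<lambda>t. \<xi> t w) (\<lambda>t. \<zeta>h t w) (\<lambda>t. \<zeta> t w) s" for s w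
  define z where "z s w = (itx (S s w), c *\<^sub>R ity (S s w))" for s w
  define ag where "ag s w = (agx (S s w), c *\<^sub>R agy (S s w))" for s w
  define md where "md s w = (mdx (S s w), c *\<^sub>R mdy (S s w))" for s w
  define zh where "zh s w = z s w - \<eta> (Suc s) *\<^sub>R (og (md s w) (\<xi> (Suc s) w) + oh (z s w) (\<zeta>h (Suc s) w))" for s w
  define w where "w = (wx, c *\<^sub>R wy)"

  have composite: "skew_composite f g h \<mu>F L_Str L_Bil w"
    unfolding f_def[abs_def] g_def h_def w_def L_Str_def L_Bil_def
    using F G \<mu>F \<mu>G c saddle[of wx wy] unfolding R_def H_def by (intro skew_composite_saddle) auto
  then interpret skew_composite f g h \<mu>F L_Str L_Bil w .
  have L_Bil_nonneg: "0 \<le> L_Bil"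
    using lambda_max_gram(1)[of B] \<mu>F \<mu>G by (simp add: L_Bil_def)

  have gradH: "grad (\<lambda>x'. H x' y) x = B *v y - ux" "grad (\<lambda>y'. H x y') y = transpose B *v x + uy" for x y
    unfolding H_def by (simp_all only: grad_coupling)
  have og_unbiased: "unbiased_oracle D\<xi> og g"
    unfolding og_def[abs_def] g_def
    using unbiased_oracle_compose[OF gf, of fst] unbiased_oracle_compose[OF gg, of snd]
    by (intro unbiased_oracle_rescale) (simp_all add: case_prod_unfold borel_measurable_continuous_onI continuous_intros)
  have oh_unbiased: "unbiased_oracle D\<zeta> oh h"
    unfolding oh_def[abs_def] h_def
    using hx unbiased_oracle_minus[OF hy] unfolding gradH
    by (intro unbiased_oracle_rescale) (simp_all add: case_prod_unfold)
  have og_var: "mean_le D\<xi> (\<lambda>s. (norm (og p s - g p))\<^sup>2) (\<sigma>_Str\<^sup>2)" for p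
    using var_Str[of "fst p" "snd p /\<^sub>R c"] by (simp only: og_def g_def norm_rescale_diff c(2))
  have oh_var: "mean_le D\<zeta> (\<lambda>s. (norm (oh p s - h p))\<^sup>2) (\<sigma>_Bil\<^sup>2)" for p
  proof -
    have "norm (- a - - b) = norm (a - b)" for a b :: "real^'m"
      by (simp add: norm_minus_commute)
    then show ?thesis
      using var_Bil[of "fst p" "snd p /\<^sub>R c"] by (simp only: oh_def h_def norm_rescale_diff c(2) gradH)
  qed

  have og_at: "og (x, c *\<^sub>R y) s = (gf x s, gg y s /\<^sub>R c)" for x y s
    using c(1) by (simp add: og_def rescale_def)
  have oh_at: "oh (x, c *\<^sub>R y) s = (hx x y s, - (hy x y s /\<^sub>R c))" for x y s
    using c(1) by (simp add: oh_def rescale_def)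
  \<comment> \<open>The \<open>y\<close>-update has step \<open>\<eta> / R\<close>; in the
    coordinate \<open>c *\<^sub>R y\<close> it becomes \<open>\<eta> / c\<close>, the very factor
    that \<open>rescale\<close> puts on the second component. One step size then serves both
    blocks.\<close>
  have dual: "c * e / R = e * inverse c" for e
    using c(1) by (simp add: c(2)[symmetric] power2_eq_square divide_inverse)
  \<comment> \<open>The half iterates are local to a step of \<open>ag_eg\<close> and not part of
    its state, so they are restated here to match the recursion.\<close>
  define xh where "xh s w = itx (S s w) - \<eta> (Suc s) *\<^sub>R (gf (mdx (S s w)) (\<xi> (Suc s) w) + hx (itx (S s w)) (ity (S s w)) (\<zeta>h (Suc s) w))" for s w
  define yh where "yh s w = ity (S s w) - (\<eta> (Suc s) / R) *\<^sub>R (- hy (itx (S s w)) (ity (S s w)) (\<zeta>h (Suc s) w) + gg (mdy (S s w)) (\<xi> (Suc s) w))" for s w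
  have zh_eq: "zh s w = (xh s w, c *\<^sub>R yh s w)" for s w
    by (simp add: zh_def z_def md_def og_at oh_at xh_def yh_def dual scaleR_diff_right)
  have z_Suc: "z (Suc s) w = z s w - \<eta> (Suc s) *\<^sub>R (og (md s w) (\<xi> (Suc s) w) + oh (zh s w) (\<zeta> (Suc s) w))" for s w
  proof -
    have "itx (S (Suc s) w) = itx (S s w) - \<eta> (Suc s) *\<^sub>R (gf (mdx (S s w)) (\<xi> (Suc s) w) + hx (xh s w) (yh s w) (\<zeta> (Suc s) w))"
      "ity (S (Suc s) w) = ity (S s w) - (\<eta> (Suc s) / R) *\<^sub>R (- hy (xh s w) (yh s w) (\<zeta> (Suc s) w) + gg (mdy (S s w)) (\<xi> (Suc s) w))"
      by (simp_all add: S_def xh_def yh_def Let_def)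
    then show ?thesis
      by (simp add: zh_eq z_def md_def og_at oh_at dual scaleR_diff_right)
  qed
  have ag_Suc: "ag (Suc s) w = (1 - \<alpha> (Suc s)) *\<^sub>R ag s w + \<alpha> (Suc s) *\<^sub>R zh s w" for s w
  proof -
    have "agx (S (Suc s) w) = (1 - \<alpha> (Suc s)) *\<^sub>R agx (S s w) + \<alpha> (Suc s) *\<^sub>R xh s w"
      "agy (S (Suc s) w) = (1 - \<alpha> (Suc s)) *\<^sub>R agy (S s w) + \<alpha> (Suc s) *\<^sub>R yh s w"
      by (simp_all add: S_def xh_def yh_def Let_def)
    then show ?thesis
      by (simp add: zh_eq ag_def scaleR_right_distrib mult.commute)
  qed
  have md_eq: "md s w = (1 - \<alpha> (Suc s)) *\<^sub>R ag s w + \<alpha> (Suc s) *\<^sub>R z s w" for s w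
    by (simp add: md_def ag_def z_def ag_eg_md[OF S_def] scaleR_right_distrib mult.commute)
  have z_0: "z 0 w = (x0 w, c *\<^sub>R y0 w)" and ag_0: "ag 0 = z 0" for w
    by (simp_all add: z_def ag_def S_def fun_eq_iff)
  have z_0_meas: "z 0 \<in> borel_measurable (A 0)"
  proof -
    have "(\<lambda>w. (x0 w, y0 w)) \<in> measurable (V Init) borel"
      by (simp add: V_def measurable_vimage_algebra1)
    then have "(\<lambda>w. (x0 w, y0 w)) \<in> borel_measurable (A 0)"
      unfolding A_def
      by (intro measurable_joint_algebra[OF V_space past_subsets(1)[of 0 0], where j=Init]) (simp_all add: past_def)
    moreover have "(\<lambda>p. (fst p, c *\<^sub>R snd p)) \<in> borel_measurable (borel :: ((real^'n) \<times> (real^'m)) measure)"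
      by (intro borel_measurable_continuous_onI continuous_intros)
    ultimately have "(\<lambda>w. (fst (x0 w, y0 w), c *\<^sub>R snd (x0 w, y0 w))) \<in> borel_measurable (A 0)"
      by (rule measurable_compose)
    then show ?thesis by (simp add: z_0[abs_def])
  qed
  have z_0_sq: "square_integrable M (z 0)"
    using x0 y0 unfolding square_integrable_def z_0[abs_def]
    by (simp add: norm_Pair power_mult_distrib borel_measurable_Pair)

  define Q where "Q = \<sigma> * sqrt (real T * (real T + 1)\<^sup>2)"
  define m where "m = max (2 / r * L_Str) (Q / (C * D0))"
  define b where "b = sqrt ((1 + \<beta>) / r) * L_Bil"
  have m_pos: "0 < m" using r(1) L_pos by (simp add: m_def less_max_iff_disj)
  have b_nonneg: "0 \<le> b" using r(1) \<beta> L_Bil_nonneg by (simp add: b_def)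
  have \<eta>_eq: "\<eta> t = real t / (m + b * real t)" for t
    by (simp add: \<eta>_def eta_bar_def m_def b_def Q_def)
  have \<sigma>_nonneg: "0 \<le> \<sigma>" and \<sigma>2: "1 / (1 - r) * \<sigma>_Str\<^sup>2 + (2 + 1 / \<beta>) * \<sigma>_Bil\<^sup>2 = 3 * \<sigma>\<^sup>2"
  proof -
    have "0 \<le> 1 / (1 - r) * \<sigma>_Str\<^sup>2 + (2 + 1 / \<beta>) * \<sigma>_Bil\<^sup>2"
      using r \<beta> by (intro add_nonneg_nonneg mult_nonneg_nonneg) auto
    then show "0 \<le> \<sigma>" "1 / (1 - r) * \<sigma>_Str\<^sup>2 + (2 + 1 / \<beta>) * \<sigma>_Bil\<^sup>2 = 3 * \<sigma>\<^sup>2"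
      by (simp_all add: \<sigma>_def power_mult_distrib power_divide)
  qed

  interpret P: ag_eg_process f g h \<mu>F L_Str L_Bil w M D\<xi> D\<zeta> og oh "\<sigma>_Str\<^sup>2" "\<sigma>_Bil\<^sup>2" r \<beta> T A A' \<xi> \<zeta>h \<zeta> \<alpha> \<eta> z zh md ag
  proof (intro ag_eg_process.intro ag_eg_process_axioms.intro composite M og_unbiased og_var oh_unbiased oh_var
      z_0_meas z_0_sq ag_0 md_eq zh_def z_Suc ag_Suc r \<beta>)
    fix s
    show "subalgebra M (A s)" if "s \<le> T"
      unfolding A_def using past_subsets(1)[OF that] V_events
      by (intro subalgebra_joint_algebra[OF V_space, where I="past T"]) auto
    assume s: "s < T"
    show "subalgebra M (A' s)"
      unfolding A'_def using past_subsets(2)[OF s] V_events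
      by (intro subalgebra_joint_algebra[OF V_space, where I="past T"]) auto
    show "subalgebra (A' s) (A s)"
      unfolding A_def A'_def
      by (rule joint_algebra_mono[OF V_space past_subsets(3) past_subsets(2)[OF s]])
    show "subalgebra (A (Suc s)) (A' s)"
      unfolding A_def A'_def using s
      by (intro joint_algebra_mono[OF V_space past_subsets(4) past_subsets(1)]) auto
    show "distr M D\<xi> (\<xi> (Suc s)) = D\<xi>" "distr M D\<zeta> (\<zeta>h (Suc s)) = D\<zeta>" "distr M D\<zeta> (\<zeta> (Suc s)) = D\<zeta>"
      using sample(2,4,6)[of "Suc s"] s by auto
    have V_meas: "\<xi> (Suc s) \<in> measurable (V (Xi (Suc s))) D\<xi>" "\<zeta>h (Suc s) \<in> measurable (V (Zeta_half (Suc s))) D\<zeta>"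
        "\<zeta> (Suc s) \<in> measurable (V (Zeta (Suc s))) D\<zeta>"
      using sample(1,3,5)[of "Suc s"] s by (auto simp: V_def measurable_space intro!: measurable_vimage_algebra1)
    note joint = measurable_joint_algebra[of "past T" V M, OF V_space]
    show "\<xi> (Suc s) \<in> measurable (A' s) D\<xi>" "\<zeta>h (Suc s) \<in> measurable (A' s) D\<zeta>"
      unfolding A'_def
      by (rule joint[OF past_subsets(2)[OF s] fresh_sources(4) V_meas(1)]
          joint[OF past_subsets(2)[OF s] fresh_sources(5) V_meas(2)])+
    show "\<zeta> (Suc s) \<in> measurable (A (Suc s)) D\<zeta>"
      unfolding A_def
      by (rule joint[OF past_subsets(1)[OF Suc_leI[OF s]] fresh_sources(6) V_meas(3)])
    note indep = indep_joint_algebra[OF V_space M V_indep]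
    show "M.indep_set (sets (A s)) (sets (vimage_algebra (space M) (\<xi> (Suc s)) D\<xi>))"
      using indep[OF past_subsets(1) fresh_in(1)[OF s] fresh_sources(1)] s by (simp add: A_def V_def)
    show "M.indep_set (sets (A s)) (sets (vimage_algebra (space M) (\<zeta>h (Suc s)) D\<zeta>))"
      using indep[OF past_subsets(1) fresh_in(2)[OF s] fresh_sources(2)] s by (simp add: A_def V_def)
    show "M.indep_set (sets (A' s)) (sets (vimage_algebra (space M) (\<zeta> (Suc s)) D\<zeta>))"
      using indep[OF past_subsets(2)[OF s] fresh_in(3)[OF s] fresh_sources(3)] by (simp add: A'_def V_def)
    show "0 < \<alpha> (Suc s) \<and> \<alpha> (Suc s) \<le> 1"
      by (simp add: \<alpha>_def)
    show "0 < \<eta> (Suc s)"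
      unfolding \<eta>_eq using m_pos b_nonneg by (intro divide_pos_pos add_pos_nonneg) auto
    show "\<alpha> (Suc s) * \<eta> (Suc s) * L_Str + (\<eta> (Suc s))\<^sup>2 * (1 + \<beta>) * L_Bil\<^sup>2 \<le> r"
      unfolding \<alpha>_def
      by (rule step_size_condition[OF L_pos r(1) \<beta> L_Bil_nonneg _ b_def _ \<eta>_eq]) (simp_all add: m_def)
  qed

  have norm_w: "(norm ((x, c *\<^sub>R y) - w))\<^sup>2 = (norm (x - wx))\<^sup>2 + R * (norm (y - wy))\<^sup>2" for x y
    using c R_pos by (simp add: w_def norm_Pair power_mult_distrib flip: scaleR_diff_right)
  have D0_eq: "(\<integral>\<omega>. (norm (z 0 \<omega> - w))\<^sup>2 \<partial>M) = D0\<^sup>2"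
    unfolding D0(1) z_0 norm_w ..
  have "mean_le M (\<lambda>\<omega>. (norm (ag T \<omega> - w))\<^sup>2)
    (2 / \<mu>F * ((m + b * real T) / (real T * (real T + 1)) *
      (D0\<^sup>2 + \<sigma>\<^sup>2 * (real T * (real T + 1)\<^sup>2) / (m + b)\<^sup>2)))"
    using P.output_distance[OF m_pos b_nonneg T _ \<eta>_eq \<sigma>2] unfolding D0_eq by (simp add: \<alpha>_def)
  moreover have "(norm (ag T \<omega> - w))\<^sup>2 = (norm (agx (out \<omega>) - wx))\<^sup>2 + R * (norm (agy (out \<omega>) - wy))\<^sup>2" for \<omega>
    unfolding ag_def norm_w by (simp add: out_def S_def)
  ultimately have "mean_le M (\<lambda>w. (norm (agx (out w) - wx))\<^sup>2 + R * (norm (agy (out w) - wy))\<^sup>2)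
      (2 / (\<mu>_Str * (real T + 1)) * (2 / r * L_Str / real T
        + prefactor L_Str L_Bil D0 T C r \<beta> \<sigma> * sqrt ((1 + \<beta>) / r) * L_Bil) * D0\<^sup>2
        + 2 * (1 / C + C) * \<sigma> / (\<mu>_Str * sqrt (real T)) * D0)"
    using final_bound[OF L_pos L_Bil_nonneg D0(2) C r(1) \<beta> \<sigma>_nonneg T \<mu>F Q_def m_def b_def]
    by (simp add: mean_le_def \<mu>_Str_def)
  moreover have "prefactor L_Str L_Bil D0 T C r \<beta> s \<in> {1..1 + C\<^sup>2}" if "s \<ge> 0" for s
    by (rule prefactor_bounds[OF L_pos L_Bil_nonneg D0(2) C r(1) \<beta> that])
  moreover have "prefactor L_Str L_Bil D0 T C r \<beta> 0 = 1"
    by (simp add: prefactor_def)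
  ultimately show ?thesis by blast
qed

end
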